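(* Let $\mathcal{Q}$ be a finite forest poset. Then the operads $\mathsf{As}(\mathcal{Q})$ and $\mathsf{ASchr}(\mathcal{Q})$ are isomorphic.
   Context: Operads are nonsymmetric over a field $\mathbb{K}$ of characteristic zero. For a finite poset $\mathcal{Q}$ and comparable $a,b$, $a\uparrow_\mathcal{Q} b:=\min(a,b)$. $\mathsf{As}(\mathcal{Q})$ is the operad generated by binary generators $\star_a$, $a\in\mathcal{Q}$, subject to the relations $\star_a\circ_1\star_b=\star_{a\uparrow_\mathcal{Q} b}\circ_2\star_{a\uparrow_\mathcal{Q} b}$ and $\star_{a\uparrow_\mathcal{Q} b}\circ_1\star_{a\uparrow_\mathcal{Q} b}=\star_a\circ_2\star_b$ for all comparable $a,b$ (including $a=b$). A forest poset is a poset with no element lying strictly above two incomparable elements. A $\mathcal{Q}$-Schröder tree is a planar rooted tree in which each internal node has at least two children and is labeled by an element of $\mathcal{Q}$; it is $\mathcal{Q}$-alternating if for every internal node $y$ whose parent $x$ is an internal node, the labels of $x$ and $y$ are incomparable. Consider the rewrite rule on $\mathcal{Q}$-Schröder trees which, whenever an internal node labeled $a$ is a child of an internal node labeled $b$ with $a,b$ comparable, contracts the edge between them: the two nodes are replaced by a single node labeled $a\uparrow_\mathcal{Q} b$ whose children are the children of $b$ with the node $a$ replaced (in place) by the sequence of children of $a$. When $\mathcal{Q}$ is a forest poset, every $\mathcal{Q}$-Schröder tree has a unique normal form for this rule, which is $\mathcal{Q}$-alternating. $\mathsf{ASchr}(\mathcal{Q})$ is the vector space spanned by $\mathcal{Q}$-alternating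 Schröder trees, graded by number of leaves, with partial composition $\mathfrak{s}\circ_i\mathfrak{t}$ defined as the normal form of the tree obtained by grafting the root of $\mathfrak{t}$ onto the $i$-th leaf of $\mathfrak{s}$, extended linearly; the unit is the one-leaf tree. *)

theory Defs
  imports "HOL-Algebra.Module" "HOL-Algebra.AbelCoset" "HOL-Library.Poly_Mapping"
begin

section \<open>Nonsymmetric operads over a field\<close>

text \<open>
  The ground field is a type of class \<^class>\<open>field\<close>, turned into a ring record so that the library's
  carrier-based modules can be used as vector spaces.
\<close>

definition scalars :: "'k::field ring" where
  "scalars = \<lparr>carrier = UNIV, monoid.mult = (*), one = 1, zero = 0, add = (+)\<rparr>"

text \<open>
  \<open>pcomp P m n i x y\<close> is the partial composition of \<open>x\<close> (of arity \<open>m\<close>) and \<open>y\<close> (of arity \<open>n\<close>) at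
  input \<open>i\<close>, with \<open>1 \<le> i \<le> m\<close>. The arities are explicit arguments since the components are not
  required to be disjoint.
\<close>

record ('k, 'a) ns_operad =
  component :: "nat \<Rightarrow> ('k, 'a) module"
  pcomp :: "nat \<Rightarrow> nat \<Rightarrow> nat \<Rightarrow> 'a \<Rightarrow> 'a \<Rightarrow> 'a"
  ounit :: 'a

abbreviation elements :: "('k, 'a) ns_operad \<Rightarrow> nat \<Rightarrow> 'a set" where
  "elements P n \<equiv> carrier (component P n)"

locale ns_operad =
  fixes P :: "('k::field, 'a) ns_operad"
  assumes vector_space: "module scalars (component P n)"
    and ounit_closed: "ounit P \<in> elements P 1"
    and pcomp_closed:
      "\<lbrakk>x \<in> elements P m; y \<in> elements P n; 1 \<le> i; i \<le> m\<rbrakk>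
        \<Longrightarrow> pcomp P m n i x y \<in> elements P (m + n - 1)"
    and pcomp_add_left:
      "\<lbrakk>x \<in> elements P m; x' \<in> elements P m; y \<in> elements P n; 1 \<le> i; i \<le> m\<rbrakk>
        \<Longrightarrow> pcomp P m n i (x \<oplus>\<^bsub>component P m\<^esub> x') y
          = pcomp P m n i x y \<oplus>\<^bsub>component P (m + n - 1)\<^esub> pcomp P m n i x' y"
    and pcomp_add_right:
      "\<lbrakk>x \<in> elements P m; y \<in> elements P n; y' \<in> elements P n; 1 \<le> i; i \<le> m\<rbrakk>
        \<Longrightarrow> pcomp P m n i x (y \<oplus>\<^bsub>component P n\<^esub> y')
          = pcomp P m n i x y \<oplus>\<^bsub>component P (m + n - 1)\<^esub> pcomp P m n i x y'"
    and pcomp_smult_left: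
      "\<lbrakk>x \<in> elements P m; y \<in> elements P n; 1 \<le> i; i \<le> m\<rbrakk>
        \<Longrightarrow> pcomp P m n i (c \<odot>\<^bsub>component P m\<^esub> x) y
          = c \<odot>\<^bsub>component P (m + n - 1)\<^esub> pcomp P m n i x y"
    and pcomp_smult_right:
      "\<lbrakk>x \<in> elements P m; y \<in> elements P n; 1 \<le> i; i \<le> m\<rbrakk>
        \<Longrightarrow> pcomp P m n i x (c \<odot>\<^bsub>component P n\<^esub> y)
          = c \<odot>\<^bsub>component P (m + n - 1)\<^esub> pcomp P m n i x y"
    and pcomp_sequential:
      "\<lbrakk>x \<in> elements P l; y \<in> elements P m; z \<in> elements P n;
        1 \<le> i; i \<le> l; 1 \<le> j; j \<le> m\<rbrakk>
        \<Longrightarrow> pcomp P (l + m - 1) n (i + j - 1) (pcomp P l m i x y) z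
          = pcomp P l (m + n - 1) i x (pcomp P m n j y z)"
    and pcomp_parallel:
      "\<lbrakk>x \<in> elements P l; y \<in> elements P m; z \<in> elements P n;
        1 \<le> i; i < k; k \<le> l\<rbrakk>
        \<Longrightarrow> pcomp P (l + m - 1) n (k + m - 1) (pcomp P l m i x y) z
          = pcomp P (l + n - 1) m i (pcomp P l n k x z) y"
    and ounit_left: "x \<in> elements P n \<Longrightarrow> pcomp P 1 n 1 (ounit P) x = x"
    and ounit_right:
      "\<lbrakk>x \<in> elements P m; 1 \<le> i; i \<le> m\<rbrakk> \<Longrightarrow> pcomp P m 1 i x (ounit P) = x"

definition operad_iso ::
    "('k::field, 'a) ns_operad \<Rightarrow> ('k, 'b) ns_operad \<Rightarrow> (nat \<Rightarrow> 'a \<Rightarrow> 'b) set" where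
  "operad_iso P R = {\<phi>.
     (\<forall>n. bij_betw (\<phi> n) (elements P n) (elements R n)) \<and>
     (\<forall>n. \<forall>x\<in>elements P n. \<forall>y\<in>elements P n.
        \<phi> n (x \<oplus>\<^bsub>component P n\<^esub> y) = \<phi> n x \<oplus>\<^bsub>component R n\<^esub> \<phi> n y) \<and>
     (\<forall>n c. \<forall>x\<in>elements P n.
        \<phi> n (c \<odot>\<^bsub>component P n\<^esub> x) = c \<odot>\<^bsub>component R n\<^esub> \<phi> n x) \<and>
     \<phi> 1 (ounit P) = ounit R \<and>
     (\<forall>m n i. \<forall>x\<in>elements P m. \<forall>y\<in>elements P n. 1 \<le> i \<and> i \<le> m \<longrightarrow>
        \<phi> (m + n - 1) (pcomp P m n i x y) = pcomp R m n i (\<phi> m x) (\<phi> n y))}"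

text \<open>
  Being isomorphic as operads includes that both sides are operads; for the two operads below this
  is not built into their construction.
\<close>

definition operads_isomorphic ::
    "('k::field, 'a) ns_operad \<Rightarrow> ('k, 'b) ns_operad \<Rightarrow> bool" where
  "operads_isomorphic P R \<longleftrightarrow> ns_operad P \<and> ns_operad R \<and> operad_iso P R \<noteq> {}"


section \<open>Ideals and quotients\<close>

definition operad_ideal :: "('k::field, 'a) ns_operad \<Rightarrow> (nat \<Rightarrow> 'a set) \<Rightarrow> bool" where
  "operad_ideal P I \<longleftrightarrow>
     (\<forall>n. submodule (I n) scalars (component P n)) \<and>
     (\<forall>m n i x y. 1 \<le> i \<and> i \<le> m \<and>
        (x \<in> I m \<and> y \<in> elements P n \<or> x \<in> elements P m \<and> y \<in> I n) \<longrightarrow>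
        pcomp P m n i x y \<in> I (m + n - 1))"

definition generated_ideal ::
    "('k::field, 'a) ns_operad \<Rightarrow> (nat \<Rightarrow> 'a set) \<Rightarrow> nat \<Rightarrow> 'a set" where
  "generated_ideal P S n = \<Inter>{I n | I. operad_ideal P I \<and> (\<forall>m. S m \<subseteq> I m)}"

text \<open>
  The fields \<^const>\<open>monoid.mult\<close> and \<^const>\<open>one\<close> of a module record play no role in the notion of
  module and are left unspecified.
\<close>

definition quotient_module ::
    "('k::field, 'a) module \<Rightarrow> 'a set \<Rightarrow> ('k, 'a set) module" where
  "quotient_module M H =
     \<lparr>carrier = a_rcosets\<^bsub>M\<^esub> H, monoid.mult = undefined, one = undefined,
      zero = H, add = set_add M, smult = (\<lambda>c X. \<Union>x\<in>X. H +>\<^bsub>M\<^esub> (c \<odot>\<^bsub>M\<^esub> x))\<rparr>"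

definition quotient_operad ::
    "('k::field, 'a) ns_operad \<Rightarrow> (nat \<Rightarrow> 'a set) \<Rightarrow> ('k, 'a set) ns_operad" where
  "quotient_operad P I =
     \<lparr>component = (\<lambda>n. quotient_module (component P n) (I n)),
      pcomp = (\<lambda>m n i X Y. \<Union>x\<in>X. \<Union>y\<in>Y.
        I (m + n - 1) +>\<^bsub>component P (m + n - 1)\<^esub> pcomp P m n i x y),
      ounit = I 1 +>\<^bsub>component P 1\<^esub> ounit P\<rparr>"


section \<open>Planar rooted trees\<close>

text \<open>Internal nodes are labelled and carry the list of their children from left to right.\<close>

datatype 'g ptree = Leaf | Node 'g "'g ptree list"

fun leaves :: "'g ptree \<Rightarrow> nat" where
  "leaves Leaf = 1"
| "leaves (Node a ts) = sum_list (map leaves ts)"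

text \<open>
  \<open>graft s i t\<close> replaces the \<open>i\<close>-th leaf of \<open>s\<close> (from left to right, starting with 1) by \<open>t\<close>;
  \<open>graft_forest\<close> does the same in a list of trees.
\<close>

fun graft :: "'g ptree \<Rightarrow> nat \<Rightarrow> 'g ptree \<Rightarrow> 'g ptree"
  and graft_forest :: "'g ptree list \<Rightarrow> nat \<Rightarrow> 'g ptree \<Rightarrow> 'g ptree list" where
  "graft Leaf i t = t"
| "graft (Node a ss) i t = Node a (graft_forest ss i t)"
| "graft_forest [] i t = []"
| "graft_forest (s # ss) i t =
     (if i \<le> leaves s then graft s i t # ss else s # graft_forest ss (i - leaves s) t)"

text \<open>
  The vector space with basis the trees in \<open>B\<close>, graded by the number of leaves, with a partial
  composition of trees \<open>f s i t\<close> extended bilinearly, and with the one-leaf tree as unit.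
\<close>

definition tree_space :: "'g ptree set \<Rightarrow> nat \<Rightarrow> ('k::field, 'g ptree \<Rightarrow>\<^sub>0 'k) module" where
  "tree_space B n =
     \<lparr>carrier = {p. Poly_Mapping.keys p \<subseteq> {t \<in> B. leaves t = n}},
      monoid.mult = undefined, one = undefined,
      zero = 0, add = (+), smult = (\<lambda>c. Poly_Mapping.map ((*) c))\<rparr>"

definition tree_operad ::
    "'g ptree set \<Rightarrow> ('g ptree \<Rightarrow> nat \<Rightarrow> 'g ptree \<Rightarrow> 'g ptree)
      \<Rightarrow> ('k::field, 'g ptree \<Rightarrow>\<^sub>0 'k) ns_operad" where
  "tree_operad B f =
     \<lparr>component = tree_space B,
      pcomp = (\<lambda>m n i p q. \<Sum>s\<in>Poly_Mapping.keys p. \<Sum>t\<in>Poly_Mapping.keys q.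
        Poly_Mapping.single (f s i t) (Poly_Mapping.lookup p s * Poly_Mapping.lookup q t)),
      ounit = Poly_Mapping.single Leaf 1\<rparr>"

text \<open>The free operad on a graded set, where \<open>G n\<close> is the set of generators of arity \<open>n\<close>.\<close>

fun syntax_tree :: "(nat \<Rightarrow> 'g set) \<Rightarrow> 'g ptree \<Rightarrow> bool" where
  "syntax_tree G Leaf \<longleftrightarrow> True"
| "syntax_tree G (Node a ts) \<longleftrightarrow> a \<in> G (length ts) \<and> (\<forall>t\<in>set ts. syntax_tree G t)"

definition free_operad :: "(nat \<Rightarrow> 'g set) \<Rightarrow> ('k::field, 'g ptree \<Rightarrow>\<^sub>0 'k) ns_operad" where
  "free_operad G = tree_operad {t. syntax_tree G t} graft"


section \<open>Posets\<close>

text \<open>A poset is a set \<open>Q\<close> with a relation \<open>r\<close> such that \<^prop>\<open>partial_order_on Q r\<close>.\<close>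

definition comparable :: "'q rel \<Rightarrow> 'q \<Rightarrow> 'q \<Rightarrow> bool" where
  "comparable r a b \<longleftrightarrow> (a, b) \<in> r \<or> (b, a) \<in> r"

text \<open>The minimum of two elements, which is only meaningful when they are comparable.\<close>

definition poset_min :: "'q rel \<Rightarrow> 'q \<Rightarrow> 'q \<Rightarrow> 'q" where
  "poset_min r a b = (if (a, b) \<in> r then a else b)"

definition forest_poset :: "'q set \<Rightarrow> 'q rel \<Rightarrow> bool" where
  "forest_poset Q r \<longleftrightarrow> partial_order_on Q r \<and>
     \<not> (\<exists>a\<in>Q. \<exists>b\<in>Q. \<exists>c\<in>Q. (a, c) \<in> r \<and> a \<noteq> c \<and> (b, c) \<in> r \<and> b \<noteq> c \<and> \<not> comparable r a b)"


section \<open>The operad As(Q)\<close>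

definition binary_generators :: "'q set \<Rightarrow> nat \<Rightarrow> 'q set" where
  "binary_generators Q n = (if n = 2 then Q else {})"

definition free_binary :: "'q set \<Rightarrow> ('k::field, 'q ptree \<Rightarrow>\<^sub>0 'k) ns_operad" where
  "free_binary Q = free_operad (binary_generators Q)"

definition star :: "'q \<Rightarrow> 'q ptree \<Rightarrow>\<^sub>0 'k::field" where
  "star a = Poly_Mapping.single (Node a [Leaf, Leaf]) 1"

definition As_relations :: "'q set \<Rightarrow> 'q rel \<Rightarrow> nat \<Rightarrow> ('q ptree \<Rightarrow>\<^sub>0 'k::field) set" where
  "As_relations Q r n = (if n = 3 then
     (let comp = pcomp (free_binary Q) 2 2; m = poset_min r in
       {comp 1 (star a) (star b) - comp 2 (star (m a b)) (star (m a b))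
          | a b. a \<in> Q \<and> b \<in> Q \<and> comparable r a b} \<union>
       {comp 1 (star (m a b)) (star (m a b)) - comp 2 (star a) (star b)
          | a b. a \<in> Q \<and> b \<in> Q \<and> comparable r a b})
     else {})"

definition As :: "'q set \<Rightarrow> 'q rel \<Rightarrow> ('k::field, ('q ptree \<Rightarrow>\<^sub>0 'k) set) ns_operad" where
  "As Q r = quotient_operad (free_binary Q) (generated_ideal (free_binary Q) (As_relations Q r))"


section \<open>The operad ASchr(Q)\<close>

fun schroeder_tree :: "'q set \<Rightarrow> 'q ptree \<Rightarrow> bool" where
  "schroeder_tree Q Leaf \<longleftrightarrow> True"
| "schroeder_tree Q (Node a ts) \<longleftrightarrow>
     a \<in> Q \<and> 2 \<le> length ts \<and> (\<forall>t\<in>set ts. schroeder_tree Q t)"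

fun alternating :: "'q rel \<Rightarrow> 'q ptree \<Rightarrow> bool" where
  "alternating r Leaf \<longleftrightarrow> True"
| "alternating r (Node a ts) \<longleftrightarrow>
     (\<forall>t\<in>set ts. alternating r t \<and> (\<forall>b us. t = Node b us \<longrightarrow> \<not> comparable r a b))"

inductive contract :: "'q rel \<Rightarrow> 'q ptree \<Rightarrow> 'q ptree \<Rightarrow> bool" for r where
  edge: "comparable r a b \<Longrightarrow>
    contract r (Node b (us @ Node a ts # vs)) (Node (poset_min r a b) (us @ ts @ vs))"
| inside: "contract r s t \<Longrightarrow> contract r (Node b (us @ s # vs)) (Node b (us @ t # vs))"

definition normal_form_of :: "'q rel \<Rightarrow> 'q ptree \<Rightarrow> 'q ptree \<Rightarrow> bool" where
  "normal_form_of r t u \<longleftrightarrow> (contract r)\<^sup>*\<^sup>* t u \<and> \<not> (\<exists>v. contract r u v)"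

definition normal_form :: "'q rel \<Rightarrow> 'q ptree \<Rightarrow> 'q ptree" where
  "normal_form r t = (THE u. normal_form_of r t u)"

definition ASchr :: "'q set \<Rightarrow> 'q rel \<Rightarrow> ('k::field, 'q ptree \<Rightarrow>\<^sub>0 'k) ns_operad" where
  "ASchr Q r = tree_operad {t. schroeder_tree Q t \<and> alternating r t}
     (\<lambda>s i t. normal_form r (graft s i t))"

end

theory Submission
  imports Defs "HOL-Library.Confluence"
begin

text \<open>
  Sending a binary tree to its normal form is compatible with grafting, hence extends to a surjective
  operad morphism from the free operad on binary generators to the operad of alternating trees; it
  kills the relations, because both sides of a relation contract to the same corolla. Conversely,
  replacing every node of a Schroeder tree by a right comb of binary nodes is a section of this
  morphism, and modulo the relations it turns every contraction into an equality. Therefore a binary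
  tree equals, modulo the relations, the comb tree of its normal form, and an element of the kernel
  lies in the ideal of relations.
\<close>


text \<open>The forest hypothesis enters through one fact: elements with a common upper bound are
  comparable. Hence if \<open>a\<close> is comparable with \<open>b\<close> and with
  \<open>c\<close>, then so is the minimum of \<open>a\<close> and \<open>b\<close> with
  \<open>c\<close>. Contracting an edge therefore never blocks a neighbouring edge, and the label
  reached after several contractions is an infimum that does not depend on their order. This is what
  makes contraction confluent. On the side of the relations the obstacle is the labels: contracting
  one edge relabels all nodes of two combs. A relation rotates two adjacent nodes and gives both the
  minimum of their labels, and its instance with equal labels rotates them back. So the smaller of
  two adjacent labels replaces the larger one, and it spreads along a comb in both directions. These
  calculations are done with an equivalence of binary trees; linear combinations appear only when it
  is compared with an ideal. That the quotient is an operad is transported from the alternating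
  trees, since its cosets are the fibres of the morphism.\<close>

section \<open>Grafting and contraction of trees\<close>

text \<open>Newman's lemma, by well-founded induction on the source of the peak.\<close>

lemma wfp_locally_confluent_imp_confluentp:
  assumes wf: "wfp R\<inverse>\<inverse>"
    and local_confl: "\<And>x y z. R x y \<Longrightarrow> R x z \<Longrightarrow> \<exists>u. R\<^sup>*\<^sup>* y u \<and> R\<^sup>*\<^sup>* z u"
  shows "confluentp R"
proof (rule confluentpI)
  show "\<exists>u. R\<^sup>*\<^sup>* y u \<and> R\<^sup>*\<^sup>* z u" if "R\<^sup>*\<^sup>* x y" "R\<^sup>*\<^sup>* x z" for x y z
    using wf that
  proof (induction x arbitrary: y z rule: wfp_induct_rule)
    case (less x)
    show ?case
    proof (cases "x = y \<or> x = z")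
      case True
      then show ?thesis using less.prems by blast
    next
      case False
      then obtain y' z' where y': "R x y'" "R\<^sup>*\<^sup>* y' y" and z': "R x z'" "R\<^sup>*\<^sup>* z' z"
        using less.prems by (metis converse_rtranclpE)
      obtain u where u: "R\<^sup>*\<^sup>* y' u" "R\<^sup>*\<^sup>* z' u"
        using local_confl y'(1) z'(1) by blast
      \<comment> \<open>The peak at \<open>y'\<close> is closed first. Its result \<open>v\<close>
        is reachable from \<open>z'\<close> through \<open>u\<close>, so the second induction
        hypothesis applies to \<open>v\<close> and \<open>z\<close>.\<close>
      obtain v where v: "R\<^sup>*\<^sup>* y v" "R\<^sup>*\<^sup>* u v"
        using less.IH[of y' y u] y' u(1) by auto
      obtain w where "R\<^sup>*\<^sup>* v w" "R\<^sup>*\<^sup>* z w"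
        using less.IH[of z' v z] z' u(2) v(2) by (metis conversepI rtranclp_trans)
      then show ?thesis using v(1) by (meson rtranclp_trans)
    qed
  qed
qed

text \<open>Meant for two contractions below one root: they concern the same child, or one child
  lies to the left of the other.\<close>

lemma append_Cons_eq_append_Cons:
  assumes "us @ x # vs = us' @ x' # vs'"
  obtains "us = us'" "x = x'" "vs = vs'"
  | ms where "us' = us @ x # ms" "vs = ms @ x' # vs'"
  | ms where "us = us' @ x' # ms" "vs' = ms @ x # vs"
  using assms by (auto simp: append_eq_append_conv2 append_eq_Cons_conv Cons_eq_append_conv)

lemma graft_forest_append_left:
  "1 \<le> i \<Longrightarrow> i \<le> sum_list (map leaves us) \<Longrightarrow>
    graft_forest (us @ vs) i t = graft_forest us i t @ vs"
  by (induction us arbitrary: i) auto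

lemma graft_forest_append_right:
  "sum_list (map leaves us) < i \<Longrightarrow>
    graft_forest (us @ vs) i t = us @ graft_forest vs (i - sum_list (map leaves us)) t"
  by (induction us arbitrary: i) auto

lemma length_graft_forest [simp]: "length (graft_forest ss i t) = length ss"
  by (induction ss arbitrary: i) auto

lemma leaves_graft:
  "1 \<le> i \<Longrightarrow> i \<le> leaves s \<Longrightarrow> leaves (graft s i t) = leaves s + leaves t - 1"
  "1 \<le> i \<Longrightarrow> i \<le> sum_list (map leaves ss) \<Longrightarrow>
    sum_list (map leaves (graft_forest ss i t)) = sum_list (map leaves ss) + leaves t - 1"
  by (induction s i t and ss i t rule: graft_graft_forest.induct) auto

lemma graft_sequential:
  "\<lbrakk>1 \<le> i; i \<le> leaves s; 1 \<le> j; j \<le> leaves t\<rbrakk> \<Longrightarrow>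
    graft (graft s i t) (i + j - 1) u = graft s i (graft t j u)"
  "\<lbrakk>1 \<le> i; i \<le> sum_list (map leaves ss); 1 \<le> j; j \<le> leaves t\<rbrakk> \<Longrightarrow>
    graft_forest (graft_forest ss i t) (i + j - 1) u = graft_forest ss i (graft t j u)"
proof (induction s i t and ss i t rule: graft_graft_forest.induct)
  case (4 s ss i t)
  show ?case
  proof (cases "i \<le> leaves s")
    case True
    then show ?thesis using 4 by (auto simp: leaves_graft)
  next
    case False
    then have "i - leaves s + j - 1 = i + j - 1 - leaves s" by simp
    then show ?thesis using 4 False by auto
  qed
qed auto

lemma graft_parallel:
  "\<lbrakk>1 \<le> i; i < k; k \<le> leaves s\<rbrakk> \<Longrightarrow>
    graft (graft s i t) (k + leaves t - 1) u = graft (graft s k u) i t"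
  "\<lbrakk>1 \<le> i; i < k; k \<le> sum_list (map leaves ss)\<rbrakk> \<Longrightarrow>
    graft_forest (graft_forest ss i t) (k + leaves t - 1) u = graft_forest (graft_forest ss k u) i t"
proof (induction s i t and ss i t arbitrary: k and k rule: graft_graft_forest.induct)
  case (4 s ss i t)
  \<comment> \<open>Both positions lie in the first tree, or its end separates them, or both lie in
    the remaining forest.\<close>
  consider "k \<le> leaves s" | "i \<le> leaves s" "leaves s < k" | "leaves s < i"
    by linarith
  then show ?case
  proof cases
    case 1
    then show ?thesis using 4 by (auto simp: leaves_graft)
  next
    case 2
    \<comment> \<open>The first tree grows to \<open>leaves s + leaves t - 1\<close> leaves. This
      matches the shift of \<open>k\<close>, so the position in the remaining forest is again
      \<open>k - leaves s\<close>.\<close>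
    then have "\<not> k + leaves t - 1 \<le> leaves (graft s i t)"
      "k + leaves t - 1 - leaves (graft s i t) = k - leaves s"
      using 4 by (auto simp: leaves_graft)
    then show ?thesis using 2 by auto
  next
    case 3
    then have "k + leaves t - 1 - leaves s = k - leaves s + leaves t - 1"
      "\<not> k + leaves t - 1 \<le> leaves s" "\<not> k \<le> leaves s"
      using 4 by auto
    then show ?thesis using 3 "4.IH"(2)[of "k - leaves s"] "4.prems" by simp
  qed
qed auto

lemma graft_forest_Leaf:
  "(\<And>s i. s \<in> set ss \<Longrightarrow> graft s i Leaf = s) \<Longrightarrow> graft_forest ss i Leaf = ss"
  by (induction ss arbitrary: i) auto

lemma graft_Leaf_right [simp]: "graft s i Leaf = s"
  by (induction s arbitrary: i) (auto simp: graft_forest_Leaf)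

lemma syntax_tree_graft:
  "syntax_tree G s \<Longrightarrow> syntax_tree G t \<Longrightarrow> syntax_tree G (graft s i t)"
  "\<forall>s\<in>set ss. syntax_tree G s \<Longrightarrow> syntax_tree G t \<Longrightarrow>
    \<forall>s\<in>set (graft_forest ss i t). syntax_tree G s"
  by (induction s i t and ss i t rule: graft_graft_forest.induct) auto

lemma schroeder_tree_graft:
  "schroeder_tree Q s \<Longrightarrow> schroeder_tree Q t \<Longrightarrow> schroeder_tree Q (graft s i t)"
  "\<forall>s\<in>set ss. schroeder_tree Q s \<Longrightarrow> schroeder_tree Q t \<Longrightarrow>
    \<forall>s\<in>set (graft_forest ss i t). schroeder_tree Q s"
  by (induction s i t and ss i t rule: graft_graft_forest.induct) auto

lemma schroeder_tree_leaves_pos: "schroeder_tree Q t \<Longrightarrow> 1 \<le> leaves t"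
proof (induction t)
  case (Node a ts)
  then show ?case by (cases ts) (auto intro: trans_le_add1)
qed simp

text \<open>
  Both kinds of contraction below a root \<open>b\<close> replace one child \<open>x\<close> by a list \<open>zs\<close> and the root
  label by \<open>c\<close>; this common form reduces local confluence to comparing the positions of two children.
\<close>

definition contract_child :: "'q rel \<Rightarrow> 'q \<Rightarrow> 'q ptree \<Rightarrow> 'q \<Rightarrow> 'q ptree list \<Rightarrow> bool" where
  "contract_child r b x c zs \<longleftrightarrow>
    (\<exists>a. x = Node a zs \<and> comparable r a b \<and> c = poset_min r a b) \<or>
    (\<exists>y. contract r x y \<and> c = b \<and> zs = [y])"

lemma contract_Leaf [simp]: "\<not> contract r Leaf t"
  by (auto elim: contract.cases)

lemma contract_Node_iff:
  "contract r (Node b xs) t \<longleftrightarrow>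
    (\<exists>us x vs c zs. xs = us @ x # vs \<and> contract_child r b x c zs \<and> t = Node c (us @ zs @ vs))"
proof
  assume "contract r (Node b xs) t"
  then show "\<exists>us x vs c zs. xs = us @ x # vs \<and> contract_child r b x c zs \<and> t = Node c (us @ zs @ vs)"
    by (cases rule: contract.cases) (force simp: contract_child_def)+
next
  assume "\<exists>us x vs c zs. xs = us @ x # vs \<and> contract_child r b x c zs \<and> t = Node c (us @ zs @ vs)"
  then show "contract r (Node b xs) t"
    by (auto simp: contract_child_def intro: contract.intros)
qed

lemma contract_NodeI:
  "contract_child r b x c zs \<Longrightarrow> contract r (Node b (us @ x # vs)) (Node c (us @ zs @ vs))"
  unfolding contract_Node_iff by blast

lemma contract_rtranclp_inside:
  "(contract r)\<^sup>*\<^sup>* s t \<Longrightarrow> (contract r)\<^sup>*\<^sup>* (Node b (us @ s # vs)) (Node b (us @ t # vs))"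
  by (induction rule: rtranclp_induct) (auto intro: contract.inside rtranclp.rtrancl_into_rtrancl)

text \<open>Each step merges two internal nodes into one.\<close>

lemma contract_size: "contract r s t \<Longrightarrow> size t < size s"
  by (induction rule: contract.induct) auto

lemma wfp_contract: "wfp (contract r)\<inverse>\<inverse>"
  by (rule wfp_if_convertible_to_nat[where f = size]) (simp add: contract_size)

lemma leaves_contract: "contract r s t \<Longrightarrow> leaves t = leaves s"
  by (induction rule: contract.induct) auto

lemma schroeder_tree_contract: "contract r s t \<Longrightarrow> schroeder_tree Q s \<Longrightarrow> schroeder_tree Q t"
  by (induction rule: contract.induct) (auto simp: poset_min_def)

text \<open>Contraction keeps the order of the leaves, so position \<open>i\<close> names the same
  leaf before and after. The cases locate this leaf relative to the contracted child.\<close>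

lemma contract_graft_left:
  assumes "contract r s s'" "1 \<le> i" "i \<le> leaves s"
  shows "contract r (graft s i t) (graft s' i t)"
  using assms
proof (induction arbitrary: i rule: contract.induct)
  case (edge a b us ts vs)
  let ?n = "\<lambda>xs. sum_list (map leaves xs)"
  consider "i \<le> ?n us" | "?n us < i" "i \<le> ?n us + ?n ts" | "?n us + ?n ts < i"
    by linarith
  then show ?case
  proof cases
    case 1
    then show ?thesis using edge by (auto simp: graft_forest_append_left intro: contract.edge)
  next
    case 2
    then show ?thesis using edge
      by (auto simp: graft_forest_append_right graft_forest_append_left intro: contract.edge)
  next
    case 3
    then have "i - (?n us + ?n ts) = i - ?n us - ?n ts" by simp
    with 3 show ?thesis using edge
      by (auto simp: graft_forest_append_right intro: contract.edge)
  qed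
next
  case (inside s s' b us vs)
  let ?n = "\<lambda>xs. sum_list (map leaves xs)"
  note [simp] = leaves_contract[OF inside.hyps(1)]
  consider "i \<le> ?n us" | "?n us < i" "i \<le> ?n us + leaves s" | "?n us + leaves s < i"
    by linarith
  then show ?case
  proof cases
    case 1
    then show ?thesis using inside by (auto simp: graft_forest_append_left intro: contract.inside)
  next
    case 2
    then show ?thesis using inside
      by (auto simp: graft_forest_append_right intro: contract.inside)
  next
    case 3
    then show ?thesis using inside
      by (auto simp: graft_forest_append_right intro: contract.inside)
  qed
qed

text \<open>The leaf count is carried through the induction because each single step needs the bound
  on \<open>i\<close> for its own source.\<close>

lemma contract_rtranclp_graft_left:
  assumes "(contract r)\<^sup>*\<^sup>* s s'" "1 \<le> i" "i \<le> leaves s"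
  shows "(contract r)\<^sup>*\<^sup>* (graft s i t) (graft s' i t) \<and> leaves s' = leaves s"
  using assms
proof (induction rule: rtranclp_induct)
  case (step s' s'')
  then show ?case
    using contract_graft_left[of r s' s'' i t] leaves_contract by fastforce
qed simp

text \<open>The prefix \<open>us\<close> collects the children already passed:
  \<open>graft_forest\<close> walks along the list, while contraction takes place below the whole
  node.\<close>

lemma contract_rtranclp_graft_right:
  assumes "(contract r)\<^sup>*\<^sup>* t t'"
  shows "(contract r)\<^sup>*\<^sup>* (graft s i t) (graft s i t')"
    and "(contract r)\<^sup>*\<^sup>* (Node b (us @ graft_forest ss i t)) (Node b (us @ graft_forest ss i t'))"
  using assms
proof (induction s i t and ss i t arbitrary: and b us rule: graft_graft_forest.induct)
  case (2 a ss i t)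
  then show ?case using "2.IH"[of a "[]"] by simp
next
  case (4 s ss i t)
  show ?case
  proof (cases "i \<le> leaves s")
    case True
    then show ?thesis using 4 contract_rtranclp_inside by auto
  next
    case False
    then show ?thesis using 4(2)[OF False, of b "us @ [s]"] 4(3) by auto
  qed
qed auto

lemma comparable_commute: "comparable r a b \<longleftrightarrow> comparable r b a"
  by (auto simp: comparable_def)

text \<open>Reads the condition on labels as irreducibility, so that the normal forms are the
  alternating trees.\<close>

lemma alternating_iff_irreducible: "alternating r t \<longleftrightarrow> \<not> (\<exists>v. contract r t v)"
proof (induction t)
  case (Node b xs)
  have "(\<exists>c zs. contract_child r b x c zs) \<longleftrightarrow>
      (\<exists>v. contract r x v) \<or> (\<exists>a ts. x = Node a ts \<and> comparable r b a)" for x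
    by (auto simp: contract_child_def comparable_commute)
  then have "(\<exists>v. contract r (Node b xs) v) \<longleftrightarrow> (\<exists>x\<in>set xs.
      (\<exists>v. contract r x v) \<or> (\<exists>a ts. x = Node a ts \<and> comparable r b a))"
    unfolding contract_Node_iff by (metis in_set_conv_decomp)
  then show ?case using Node by auto
qed simp

section \<open>Minima in a forest poset and local confluence of contraction\<close>

locale forest =
  fixes Q :: "'q set" and r :: "'q rel"
  assumes forest_poset: "forest_poset Q r"
begin

abbreviation le (infix \<open>\<preceq>\<close> 50) where "a \<preceq> b \<equiv> (a, b) \<in> r"
abbreviation cmp (infix \<open>\<asymp>\<close> 50) where "a \<asymp> b \<equiv> comparable r a b"
abbreviation m where "m \<equiv> poset_min r"

lemma le_refl: "a \<in> Q \<Longrightarrow> a \<preceq> a"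
  and le_trans: "a \<preceq> b \<Longrightarrow> b \<preceq> c \<Longrightarrow> a \<preceq> c"
  and le_antisym: "a \<preceq> b \<Longrightarrow> b \<preceq> a \<Longrightarrow> a = b"
  and le_Q: "a \<preceq> b \<Longrightarrow> a \<in> Q \<and> b \<in> Q"
  using forest_poset
  by (auto simp: forest_poset_def partial_order_on_def preorder_on_def
      dest: refl_onD transD antisymD)

text \<open>The forest condition, read as: down-sets are chains. The definition speaks of elements
  strictly below \<open>c\<close>; if one of the two equals \<open>c\<close>, the other hypothesis
  already compares them.\<close>

lemma le_downward: "a \<preceq> c \<Longrightarrow> b \<preceq> c \<Longrightarrow> a \<asymp> b"
  using forest_poset le_Q unfolding forest_poset_def comparable_def by metis

lemma cmp_Q: "a \<asymp> b \<Longrightarrow> a \<in> Q \<and> b \<in> Q"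
  using le_Q by (auto simp: comparable_def)

lemma cmp_refl: "a \<in> Q \<Longrightarrow> a \<asymp> a"
  by (simp add: comparable_def le_refl)

lemma min_commute: "a \<asymp> b \<Longrightarrow> m a b = m b a"
  by (auto simp: comparable_def poset_min_def dest: le_antisym)

lemma le_min_iff: "a \<asymp> b \<Longrightarrow> z \<preceq> m a b \<longleftrightarrow> z \<preceq> a \<and> z \<preceq> b"
  by (auto simp: comparable_def poset_min_def dest: le_trans)

text \<open>Together with \<open>le_min_iff\<close> this proves identities between iterated minima
  by comparing lower bounds.\<close>

lemma eq_if_same_lower: "a \<in> Q \<Longrightarrow> b \<in> Q \<Longrightarrow> (\<And>z. z \<preceq> a \<longleftrightarrow> z \<preceq> b) \<Longrightarrow> a = b"
  using le_refl le_antisym by blast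

lemma min_le: "a \<asymp> b \<Longrightarrow> m a b \<preceq> a" "a \<asymp> b \<Longrightarrow> m a b \<preceq> b"
  using cmp_Q le_refl by (auto simp: comparable_def poset_min_def)

text \<open>The elements \<open>b\<close> and \<open>c\<close> may be incomparable. If
  \<open>a\<close> is below \<open>c\<close>, then so is the minimum; otherwise \<open>c\<close> and
  the minimum both lie below \<open>a\<close>, and the forest condition compares them.\<close>

lemma min_cmp:
  assumes "a \<asymp> b" "a \<asymp> c"
  shows "m a b \<asymp> c"
proof (cases "a \<preceq> c")
  case True
  then show ?thesis using min_le(1)[OF assms(1)] le_trans by (auto simp: comparable_def)
next
  case False
  then have "c \<preceq> a" using assms(2) by (simp add: comparable_def)
  then show ?thesis using min_le(1)[OF assms(1)] le_downward by blast
qed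

text \<open>Two siblings labelled \<open>a\<close> and \<open>c\<close> are absorbed by their parent
  \<open>b\<close>: in either order the result is the infimum of the three labels.\<close>

lemma min_left_commute:
  assumes "a \<asymp> b" "c \<asymp> b"
  shows "m c (m a b) = m a (m c b)"
proof -
  have 1: "c \<asymp> m a b" "a \<asymp> m c b"
    using assms min_cmp min_commute comparable_commute by metis+
  show ?thesis
    using cmp_Q[OF 1(1)] cmp_Q[OF 1(2)] le_min_iff[OF 1(1)] le_min_iff[OF 1(2)]
      le_min_iff[OF assms(1)] le_min_iff[OF assms(2)]
    by (intro eq_if_same_lower) (auto simp: poset_min_def)
qed

text \<open>The case of a chain in the tree: \<open>c\<close> is a child of \<open>a\<close>, and
  \<open>a\<close> a child of \<open>b\<close>. Up to commutativity it is
  \<open>min_left_commute\<close> centred at \<open>a\<close>.\<close>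

lemma min_assoc:
  assumes "a \<asymp> b" "c \<asymp> a"
  shows "m c (m a b) = m (m c a) b"
proof -
  have "c \<asymp> m a b" using assms min_cmp comparable_commute by metis
  moreover have "m c a \<asymp> b"
    using assms min_cmp[of a c b] min_commute[of c a] comparable_commute by metis
  ultimately show ?thesis
    using min_left_commute[of b a c] min_commute[of a b] min_commute[of "m c a" b] assms
    by (simp add: comparable_commute)
qed

text \<open>Contracting one child changes only the root label that the other child sees. The label
  \<open>e\<close> is the one reached in either order; if both children are absorbed, this is
  \<open>min_left_commute\<close>.\<close>

lemma contract_child_commute:
  assumes "contract_child r b x c zs" "contract_child r b y d ws"
  shows "\<exists>e. contract_child r c y e ws \<and> contract_child r d x e zs"
  using assms min_cmp min_commute min_left_commute comparable_commute
  unfolding contract_child_def by (smt (verit))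

text \<open>Once \<open>a\<close> is absorbed, its child \<open>y\<close> hangs directly from the
  node labelled \<open>m a b\<close>. Comparability of \<open>a'\<close> and \<open>b\<close> says
  that contracting the lower place first does not block the upper edge.\<close>

lemma contract_child_nested:
  assumes "a \<asymp> b" "contract_child r a y a' ys"
  shows "a' \<asymp> b \<and> contract_child r (m a b) y (m a' b) ys"
proof -
  consider d where "y = Node d ys" "d \<asymp> a" "a' = m d a" | z where "contract r y z" "a' = a" "ys = [z]"
    using assms(2) unfolding contract_child_def by blast
  then show ?thesis
  proof cases
    case y: (1 d)
    have "m d a \<asymp> b" using min_cmp[of a d b] min_commute[of d a] assms(1) y(2)
      by (simp add: comparable_commute)
    moreover have "d \<asymp> m a b" using min_cmp[of a b d] assms(1) y(2) by (simp add: comparable_commute)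
    ultimately show ?thesis using y min_assoc[OF assms(1) y(2)]
      unfolding contract_child_def by auto
  next
    case 2
    then show ?thesis using assms(1) unfolding contract_child_def by blast
  qed
qed

abbreviation joinable where
  "joinable s t \<equiv> \<exists>u. (contract r)\<^sup>*\<^sup>* s u \<and> (contract r)\<^sup>*\<^sup>* t u"

text \<open>The genuine overlap: a node is either absorbed by its parent or contracted inside. One
  more step on each side reaches the root label \<open>m a' b\<close>.\<close>

lemma joinable_absorbed_child:
  assumes "a \<asymp> b" "contract r (Node a ts) y"
  shows "joinable (Node (m a b) (us @ ts @ vs)) (Node b (us @ y # vs))"
proof -
  obtain p x q a' zs where
    ts: "ts = p @ x # q" and x: "contract_child r a x a' zs" and y: "y = Node a' (p @ zs @ q)"
    using assms(2) unfolding contract_Node_iff by blast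
  note nested = contract_child_nested[OF assms(1) x]
  have "contract r (Node (m a b) ((us @ p) @ x # (q @ vs))) (Node (m a' b) ((us @ p) @ zs @ (q @ vs)))"
    using nested by (intro contract_NodeI) simp
  moreover have "contract r (Node b (us @ y # vs)) (Node (m a' b) (us @ (p @ zs @ q) @ vs))"
    using nested unfolding y by (intro contract.edge) simp
  ultimately show ?thesis unfolding ts by (auto 4 3)
qed

lemma contract_locally_confluent:
  "contract r s t \<Longrightarrow> contract r s t' \<Longrightarrow> joinable t t'"
proof (induction s arbitrary: t t')
  case (Node b xs)
  obtain us x vs c zs where
    t: "xs = us @ x # vs" "contract_child r b x c zs" "t = Node c (us @ zs @ vs)"
    using Node.prems(1) unfolding contract_Node_iff by blast
  obtain us' x' vs' c' zs' where
    t': "xs = us' @ x' # vs'" "contract_child r b x' c' zs'" "t' = Node c' (us' @ zs' @ vs')"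
    using Node.prems(2) unfolding contract_Node_iff by blast
  obtain e where e: "contract_child r c x' e zs'" "contract_child r c' x e zs"
    using contract_child_commute[OF t(2) t'(2)] by blast
  from t(1) t'(1) have "us @ x # vs = us' @ x' # vs'" by simp
  then show ?case
  proof (cases rule: append_Cons_eq_append_Cons)
    case 1
    have x: "x \<in> set xs" using t by simp
    show ?thesis
      \<comment> \<open>Same child: absorbing it on both sides gives equal results, absorbing
        against contracting inside is \<open>joinable_absorbed_child\<close>, and two contractions
        inside fall to the induction hypothesis.\<close>
      using t(2) t'(2) unfolding contract_child_def 1[symmetric]
    proof (elim disjE exE conjE)
      fix a a' assume "x = Node a zs" "c = m a b" "x = Node a' zs'" "c' = m a' b"
      then show ?thesis using t t' 1 by auto
    next
      fix a y assume "x = Node a zs" "a \<asymp> b" "c = m a b" "contract r x y" "c' = b" "zs' = [y]"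
      then show ?thesis using joinable_absorbed_child[of a b zs y us vs] t t' 1 by simp
    next
      fix a y assume "x = Node a zs'" "a \<asymp> b" "c' = m a b" "contract r x y" "c = b" "zs = [y]"
      then show ?thesis using joinable_absorbed_child[of a b zs' y us vs] t t' 1 by auto
    next
      fix y y' assume y: "contract r x y" "c = b" "zs = [y]" "contract r x y'" "c' = b" "zs' = [y']"
      then obtain u where "(contract r)\<^sup>*\<^sup>* y u" "(contract r)\<^sup>*\<^sup>* y' u"
        using Node.IH[OF x] by blast
      then show ?thesis using y t t' 1 by (auto intro!: exI[of _ "Node b (us @ u # vs)"] contract_rtranclp_inside)
    qed
  next
    \<comment> \<open>Distinct children: the other contraction is still available on each side, and
      one step leads to the common root label \<open>e\<close>.\<close>
    case (2 ms)
    have "contract r (Node c ((us @ zs @ ms) @ x' # vs')) (Node e ((us @ zs @ ms) @ zs' @ vs'))"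
      "contract r (Node c' (us @ x # (ms @ zs' @ vs'))) (Node e (us @ zs @ (ms @ zs' @ vs')))"
      using e by (auto intro!: contract_NodeI simp del: append_assoc)
    then show ?thesis unfolding t(3) t'(3) 2 by (auto 4 3)
  next
    case (3 ms)
    have "contract r (Node c (us' @ x' # (ms @ zs @ vs))) (Node e (us' @ zs' @ (ms @ zs @ vs)))"
      "contract r (Node c' ((us' @ zs' @ ms) @ x # vs)) (Node e ((us' @ zs' @ ms) @ zs @ vs))"
      using e by (auto intro!: contract_NodeI simp del: append_assoc)
    then show ?thesis unfolding t(3) t'(3) 3 by (auto 4 3)
  qed
qed simp

lemma confluentp_contract: "confluentp (contract r)"
  using wfp_locally_confluent_imp_confluentp[OF wfp_contract] contract_locally_confluent by blast

section \<open>Normal forms and their compatibility with grafting\<close>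

lemma normal_form_of_exists: "\<exists>u. normal_form_of r t u"
proof (induction "size t" arbitrary: t rule: less_induct)
  case less
  show ?case
  proof (cases "\<exists>v. contract r t v")
    case True
    then show ?thesis
      using less contract_size unfolding normal_form_of_def by (meson converse_rtranclp_into_rtranclp)
  next
    case False
    then show ?thesis unfolding normal_form_of_def by blast
  qed
qed

lemma normal_form_of_unique:
  "normal_form_of r t u \<Longrightarrow> normal_form_of r t v \<Longrightarrow> u = v"
  using confluentpD[OF confluentp_contract] unfolding normal_form_of_def
  by (metis converse_rtranclpE)

lemma normal_form: "normal_form_of r t (normal_form r t)"
  unfolding normal_form_def using normal_form_of_exists normal_form_of_unique
  by (metis theI_unique)

lemma contract_rtranclp_normal_form: "(contract r)\<^sup>*\<^sup>* t (normal_form r t)"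
  using normal_form by (simp add: normal_form_of_def)

lemma normal_form_eqI: "(contract r)\<^sup>*\<^sup>* s t \<Longrightarrow> normal_form r s = normal_form r t"
  using normal_form[of s] normal_form[of t] normal_form_of_unique[of s]
  unfolding normal_form_of_def by (meson rtranclp_trans)

lemma alternating_normal_form: "alternating r (normal_form r t)"
  using normal_form unfolding alternating_iff_irreducible normal_form_of_def by blast

lemma normal_form_alternating: "alternating r t \<Longrightarrow> normal_form r t = t"
  using contract_rtranclp_normal_form unfolding alternating_iff_irreducible
  by (metis converse_rtranclpE)

lemma leaves_normal_form [simp]: "leaves (normal_form r t) = leaves t"
  using contract_rtranclp_normal_form[of t] by (induction rule: rtranclp_induct) (auto simp: leaves_contract)

lemma schroeder_tree_normal_form:
  "schroeder_tree Q t \<Longrightarrow> schroeder_tree Q (normal_form r t)"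
  using contract_rtranclp_normal_form[of t]
  by (induction rule: rtranclp_induct) (auto intro: schroeder_tree_contract)

text \<open>A reduction of \<open>s\<close> lifts to a reduction of the grafted tree, and normal
  forms are unique. The operad axioms for \<open>ASchr\<close> and the morphism property of
  normalisation rest on this and on \<open>normal_form_graft_right\<close>.\<close>

lemma normal_form_graft_left:
  "1 \<le> i \<Longrightarrow> i \<le> leaves s \<Longrightarrow> normal_form r (graft (normal_form r s) i t) = normal_form r (graft s i t)"
  using contract_rtranclp_graft_left contract_rtranclp_normal_form normal_form_eqI by metis

lemma normal_form_graft_right:
  "normal_form r (graft s i (normal_form r t)) = normal_form r (graft s i t)"
  using contract_rtranclp_graft_right(1) contract_rtranclp_normal_form normal_form_eqI by metis

end


section \<open>Right combs modulo the relations\<close>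

lemma binary_generators_iff [simp]: "a \<in> binary_generators Q n \<longleftrightarrow> n = 2 \<and> a \<in> Q"
  by (simp add: binary_generators_def)

abbreviation binary_tree :: "'q set \<Rightarrow> 'q ptree \<Rightarrow> bool" where
  "binary_tree Q \<equiv> syntax_tree (binary_generators Q)"

lemma schroeder_tree_binary: "binary_tree Q t \<Longrightarrow> schroeder_tree Q t"
  by (induction t) auto

text \<open>The value at the empty list is a default. A single tree needs no node, so
  \<open>n\<close> trees are joined by \<open>n - 1\<close> nodes and the label is lost for
  \<open>n = 1\<close>; several length conditions below guard against this.\<close>

fun comb :: "'q \<Rightarrow> 'q ptree list \<Rightarrow> 'q ptree" where
  "comb a [] = Leaf"
| "comb a [t] = t"
| "comb a (t # u # us) = Node a [t, comb a (u # us)]"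

fun binarize :: "'q ptree \<Rightarrow> 'q ptree" where
  "binarize Leaf = Leaf"
| "binarize (Node a ts) = comb a (map binarize ts)"

lemma comb_Cons: "us \<noteq> [] \<Longrightarrow> comb a (t # us) = Node a [t, comb a us]"
  by (cases us) auto

text \<open>Every nonempty end of a comb is itself a comb, so changes can be made at the last
  entry.\<close>

lemma comb_append: "vs \<noteq> [] \<Longrightarrow> comb a (us @ vs) = comb a (us @ [comb a vs])"
  by (induction us) (auto simp: comb_Cons)

lemma binary_tree_comb:
  "a \<in> Q \<Longrightarrow> \<forall>t\<in>set ts. binary_tree Q t \<Longrightarrow> binary_tree Q (comb a ts)"
  by (induction a ts rule: comb.induct) auto

lemma leaves_comb: "ts \<noteq> [] \<Longrightarrow> leaves (comb a ts) = sum_list (map leaves ts)"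
  by (induction a ts rule: comb.induct) auto

lemma binary_tree_binarize: "schroeder_tree Q t \<Longrightarrow> binary_tree Q (binarize t)"
  by (induction t) (auto intro!: binary_tree_comb)

lemma leaves_binarize: "schroeder_tree Q t \<Longrightarrow> leaves (binarize t) = leaves t"
proof (induction t)
  case (Node a ts)
  then have "ts \<noteq> []" "map (leaves \<circ> binarize) ts = map leaves ts" by auto
  then show ?case by (simp add: leaves_comb del: map_eq_conv)
qed simp

lemma binarize_binary_tree: "binary_tree Q t \<Longrightarrow> binarize t = t"
proof (induction t)
  case (Node a ts)
  then obtain t u where "ts = [t, u]" by (auto simp: length_Suc_conv numeral_2_eq_2)
  then show ?case using Node by simp
qed simp

lemma contract_rtranclp_children:
  "(\<And>t. t \<in> set ts \<Longrightarrow> (contract r)\<^sup>*\<^sup>* (f t) t) \<Longrightarrow>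
    (contract r)\<^sup>*\<^sup>* (Node a (us @ map f ts)) (Node a (us @ ts))"
proof (induction ts arbitrary: us)
  case (Cons t ts)
  have "(contract r)\<^sup>*\<^sup>* (Node a (us @ f t # map f ts)) (Node a (us @ t # map f ts))"
    by (rule contract_rtranclp_inside) (simp add: Cons.prems)
  also have "(contract r)\<^sup>*\<^sup>* (Node a (us @ t # map f ts)) (Node a (us @ t # ts))"
    using Cons.IH[of "us @ [t]"] Cons.prems by simp
  finally show ?case by simp
qed simp

text \<open>The congruence on binary trees generated by the relations of \<open>As\<close>, with
  arbitrary binary trees in place of the three leaves. Reflexivity is limited to binary trees so
  that only such trees are related. The passage to ideals is
  \<open>assoc_equiv_congruent_mod\<close>.\<close>

inductive assoc_equiv :: "'q set \<Rightarrow> 'q rel \<Rightarrow> 'q ptree \<Rightarrow> 'q ptree \<Rightarrow> bool" for Q r where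
  refl: "binary_tree Q t \<Longrightarrow> assoc_equiv Q r t t"
| sym: "assoc_equiv Q r s t \<Longrightarrow> assoc_equiv Q r t s"
| trans: "assoc_equiv Q r s t \<Longrightarrow> assoc_equiv Q r t u \<Longrightarrow> assoc_equiv Q r s u"
| cong: "a \<in> Q \<Longrightarrow> assoc_equiv Q r s s' \<Longrightarrow> assoc_equiv Q r t t' \<Longrightarrow>
    assoc_equiv Q r (Node a [s, t]) (Node a [s', t'])"
| left: "\<lbrakk>a \<in> Q; b \<in> Q; comparable r a b; binary_tree Q s; binary_tree Q t; binary_tree Q u\<rbrakk> \<Longrightarrow>
    assoc_equiv Q r (Node a [Node b [s, t], u])
      (Node (poset_min r a b) [s, Node (poset_min r a b) [t, u]])"
| right: "\<lbrakk>a \<in> Q; b \<in> Q; comparable r a b; binary_tree Q s; binary_tree Q t; binary_tree Q u\<rbrakk> \<Longrightarrow>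
    assoc_equiv Q r (Node (poset_min r a b) [Node (poset_min r a b) [s, t], u])
      (Node a [s, Node b [t, u]])"

lemma poset_min_in: "a \<in> Q \<Longrightarrow> b \<in> Q \<Longrightarrow> poset_min r a b \<in> Q"
  by (simp add: poset_min_def)

lemma assoc_equiv_binary_tree:
  "assoc_equiv Q r s t \<Longrightarrow> binary_tree Q s \<and> binary_tree Q t"
  by (induction rule: assoc_equiv.induct) (auto simp: poset_min_in)

section \<open>Spreading labels along combs modulo the relations\<close>

context forest
begin

abbreviation equ (infix \<open>\<approx>\<close> 50) where "s \<approx> t \<equiv> assoc_equiv Q r s t"
abbreviation bin where "bin \<equiv> binary_tree Q"

lemmas [trans] = assoc_equiv.trans
lemmas [simp] = poset_min_in

lemma min_absorb: "c \<preceq> b \<Longrightarrow> m b c = c"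
  by (auto simp: poset_min_def dest: le_antisym)

lemma comb_cong_last:
  "a \<in> Q \<Longrightarrow> \<forall>u\<in>set us. bin u \<Longrightarrow> s \<approx> t \<Longrightarrow> comb a (us @ [s]) \<approx> comb a (us @ [t])"
  by (induction us) (auto simp: comb_Cons intro: assoc_equiv.intros)

lemma comb_cong:
  assumes "a \<in> Q" "\<forall>u\<in>set us. bin u" "\<forall>v\<in>set vs. bin v" "s \<approx> t"
  shows "comb a (us @ s # vs) \<approx> comb a (us @ t # vs)"
proof -
  have "comb a (s # vs) \<approx> comb a (t # vs)"
    using assms by (cases vs) (auto intro!: assoc_equiv.cong assoc_equiv.refl binary_tree_comb)
  then show ?thesis
    using comb_cong_last[OF assms(1,2)] comb_append[of "s # vs" a us] comb_append[of "t # vs" a us]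
    by simp
qed

text \<open>The rule \<open>right\<close>, read backwards, rotates to the left and gives both nodes
  the minimum; the rule \<open>left\<close> with equal labels rotates back.\<close>

lemma right_comb:
  assumes "a \<in> Q" "b \<in> Q" "b \<asymp> a" "bin s" "bin t" "bin u"
  shows "Node a [s, Node b [t, u]] \<approx> Node (m b a) [s, Node (m b a) [t, u]]"
proof -
  have "m b a = m a b" using assms(3) min_commute by simp
  have "Node a [s, Node b [t, u]] \<approx> Node (m a b) [Node (m a b) [s, t], u]"
    using assms by (intro assoc_equiv.sym[OF assoc_equiv.right]) (simp_all add: comparable_commute)
  also have "\<dots> \<approx> Node (m a b) [s, Node (m a b) [t, u]]"
    using assoc_equiv.left[of "m a b" Q "m a b" r s t u] assms by (simp add: cmp_refl poset_min_def)
  finally show ?thesis using \<open>m b a = m a b\<close> by simp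
qed

lemma left_comb:
  assumes "a \<in> Q" "b \<in> Q" "b \<asymp> a" "bin s" "bin t" "bin u"
  shows "Node a [Node b [s, t], u] \<approx> Node (m b a) [s, Node (m b a) [t, u]]"
  using assoc_equiv.left[of a Q b r s t u] assms min_commute comparable_commute by metis

text \<open>By \<open>right_comb\<close> each node of the comb takes the minimum of its label and
  the label \<open>c\<close> above it, which is \<open>c\<close>. One level down \<open>w\<close>
  plays the role of \<open>s\<close>, hence the generalisation.\<close>

lemma comb_below:
  assumes "c \<preceq> b"
  shows "\<lbrakk>ws \<noteq> []; bin s; \<forall>w\<in>set ws. bin w\<rbrakk> \<Longrightarrow> Node c [s, comb b ws] \<approx> Node c [s, comb c ws]"
proof (induction ws arbitrary: s)
  case (Cons w ws)
  have Q: "c \<in> Q" "b \<in> Q" using assms le_Q by auto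
  show ?case
  proof (cases "ws = []")
    case False
    have "Node c [s, Node b [w, comb b ws]] \<approx> Node c [s, Node c [w, comb b ws]]"
      using right_comb[of c b s w "comb b ws"] Cons.prems Q assms
      by (simp add: min_absorb comparable_def binary_tree_comb)
    also have "\<dots> \<approx> Node c [s, Node c [w, comb c ws]]"
      using Cons.prems Q by (intro assoc_equiv.cong[OF Q(1) assoc_equiv.refl Cons.IH] False) auto
    finally show ?thesis by (simp add: comb_Cons False)
  qed (use Cons Q in \<open>auto intro: assoc_equiv.intros\<close>)
qed simp

text \<open>One use of \<open>left_comb\<close> moves the first entry out. The rest of the comb is
  then a left child below the label \<open>m a b\<close>, so the induction needs arbitrary
  \<open>b\<close>, and \<open>m a (m a b) = m a b\<close> keeps the label from then on.\<close>

lemma comb_left_child: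
  "\<lbrakk>ts \<noteq> []; a \<asymp> b; bin s; bin u; \<forall>t\<in>set ts. bin t\<rbrakk> \<Longrightarrow>
    Node b [comb a (s # ts), u] \<approx> comb (m a b) (s # ts @ [u])"
proof (induction ts arbitrary: s b)
  case (Cons t ts)
  have Q: "a \<in> Q" "b \<in> Q" "m a b \<in> Q" using Cons.prems cmp_Q by auto
  have le: "m a b \<preceq> a" using Cons.prems min_le by blast
  let ?c = "m a b"
  have "Node b [Node a [s, comb a (t # ts)], u] \<approx> Node ?c [s, Node ?c [comb a (t # ts), u]]"
    using Cons.prems Q by (intro left_comb binary_tree_comb) auto
  also have "\<dots> \<approx> Node ?c [s, comb ?c (t # ts @ [u])]"
  proof (cases "ts = []")
    case True
    then show ?thesis using Cons Q by (auto intro: assoc_equiv.refl)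
  next
    case False
    have "m a ?c = ?c" using min_absorb[OF le] .
    then have "Node ?c [comb a (t # ts), u] \<approx> comb ?c (t # ts @ [u])"
      using Cons.IH[of ?c t] False Cons.prems le by (simp add: comparable_def)
    then show ?thesis using Q Cons.prems by (intro assoc_equiv.cong assoc_equiv.refl) auto
  qed
  finally show ?case by (simp add: comb_Cons)
qed simp

text \<open>With a single entry in \<open>ts\<close> the left side would contain no node labelled
  \<open>a\<close>. Otherwise \<open>right_comb\<close> relabels the two top nodes and
  \<open>comb_below\<close> the others.\<close>

lemma comb_right_child:
  assumes "2 \<le> length ts" "a \<asymp> b" "bin s" "\<forall>t\<in>set ts. bin t"
  shows "Node b [s, comb a ts] \<approx> comb (m a b) (s # ts)"
proof -
  obtain t us where ts: "ts = t # us" "us \<noteq> []" using assms(1) by (cases ts) (auto simp: Suc_le_eq)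
  have Q: "a \<in> Q" "b \<in> Q" "m a b \<in> Q" using assms cmp_Q by auto
  let ?c = "m a b"
  have "Node b [s, Node a [t, comb a us]] \<approx> Node ?c [s, Node ?c [t, comb a us]]"
    using assms Q ts by (intro right_comb binary_tree_comb) auto
  also have "\<dots> \<approx> Node ?c [s, Node ?c [t, comb ?c us]]"
    using assms Q ts by (intro assoc_equiv.cong assoc_equiv.refl comb_below min_le) auto
  finally show ?thesis using ts by (simp add: comb_Cons)
qed

text \<open>Here the smaller label \<open>c\<close> spreads towards the root; in
  \<open>comb_suffix\<close> it spreads towards the end of the comb.\<close>

lemma comb_prefix:
  assumes "c \<preceq> b" "2 \<le> length ws" "\<forall>w\<in>set ws. bin w"
  shows "\<forall>u\<in>set us. bin u \<Longrightarrow> comb b (us @ [comb c ws]) \<approx> comb c (us @ ws)"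
proof (induction us)
  case Nil
  then show ?case using assms le_Q by (auto intro!: assoc_equiv.refl binary_tree_comb)
next
  case (Cons u us)
  have Q: "c \<in> Q" "b \<in> Q" using assms le_Q by auto
  have "Node b [u, comb b (us @ [comb c ws])] \<approx> Node b [u, comb c (us @ ws)]"
    using Cons Q by (auto intro: assoc_equiv.cong assoc_equiv.refl)
  also have "\<dots> \<approx> comb c (u # us @ ws)"
    using comb_right_child[of "us @ ws" c b u] Cons.prems assms
    by (auto simp: comparable_def poset_min_def)
  finally show ?case by (simp add: comb_Cons)
qed

lemma comb_suffix:
  assumes "c \<preceq> b" "vs \<noteq> []" "\<forall>v\<in>set vs. bin v"
  shows "\<lbrakk>ts \<noteq> []; \<forall>t\<in>set ts. bin t\<rbrakk> \<Longrightarrow> comb c (ts @ [comb b vs]) \<approx> comb c (ts @ vs)"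
proof (induction ts)
  case (Cons t ts)
  have Q: "c \<in> Q" "b \<in> Q" using assms le_Q by auto
  show ?case
  proof (cases "ts = []")
    case True
    then show ?thesis using comb_below[OF assms(1,2)] assms Cons.prems by (simp add: comb_Cons)
  next
    case False
    then show ?thesis using Cons Q by (auto simp: comb_Cons intro: assoc_equiv.cong assoc_equiv.refl)
  qed
qed simp

text \<open>The equality behind a contracted edge. The condition on \<open>us @ vs\<close> gives the
  parent a second child; with an only child its comb would have no node labelled
  \<open>b\<close>.\<close>

lemma comb_contract:
  assumes "a \<asymp> b" "2 \<le> length ts" "us @ vs \<noteq> []"
    and bin: "\<forall>t\<in>set us \<union> set ts \<union> set vs. bin t"
  shows "comb b (us @ comb a ts # vs) \<approx> comb (m a b) (us @ ts @ vs)"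
proof -
  let ?c = "m a b"
  have Q: "a \<in> Q" "b \<in> Q" "?c \<in> Q" and le: "?c \<preceq> b" using assms cmp_Q min_le by auto
  \<comment> \<open>With siblings to its right, the comb of \<open>a\<close> is a left child inside
    the comb of \<open>b\<close>; as the last child it is a right child, beside the last sibling
    \<open>u\<close>.\<close>
  show ?thesis
  proof (cases "vs = []")
    case False
    obtain t ts' where ts: "ts = t # ts'" "ts' \<noteq> []" using assms(2) by (cases ts) (auto simp: Suc_le_eq)
    have "Node b [comb a ts, comb b vs] \<approx> comb ?c (ts @ [comb b vs])"
      unfolding ts using comb_left_child[of ts' a b t "comb b vs"] assms Q ts
      by (auto intro: binary_tree_comb)
    also have "\<dots> \<approx> comb ?c (ts @ vs)"
      using comb_suffix[OF le False, of ts] bin ts by auto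
    finally have "comb b (us @ [Node b [comb a ts, comb b vs]]) \<approx> comb b (us @ [comb ?c (ts @ vs)])"
      using bin Q by (intro comb_cong_last) auto
    also have "\<dots> \<approx> comb ?c (us @ ts @ vs)"
      using bin assms(2) le by (intro comb_prefix) auto
    finally show ?thesis
      using comb_append[of "comb a ts # vs" b us] False by (simp add: comb_Cons)
  next
    case True
    then obtain us' u where us: "us = us' @ [u]" using assms(3) by (cases us rule: rev_cases) auto
    have "comb b (us' @ [Node b [u, comb a ts]]) \<approx> comb b (us' @ [comb ?c (u # ts)])"
      using bin Q assms(1,2) us by (intro comb_cong_last comb_right_child) auto
    also have "\<dots> \<approx> comb ?c (us' @ u # ts)"
      using bin assms(2) le us by (intro comb_prefix) auto
    finally show ?thesis
      using comb_append[of "[u, comb a ts]" b us'] True us by simp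
  qed
qed

lemma binarize_contract: "contract r s t \<Longrightarrow> schroeder_tree Q s \<Longrightarrow> binarize s \<approx> binarize t"
proof (induction rule: contract.induct)
  case (edge a b us ts vs)
  then show ?case
    using comb_contract[of a b "map binarize ts" "map binarize us" "map binarize vs"]
    by (fastforce simp: binary_tree_binarize)
next
  case (inside s t b us vs)
  then show ?case
    using comb_cong[of b "map binarize us" "map binarize vs" "binarize s" "binarize t"]
    by (auto simp: binary_tree_binarize)
qed

text \<open>A binary tree is its own binarization, so \<open>binarize_contract\<close> can be
  chained along a reduction that starts at it.\<close>

lemma binarize_normal_form:
  assumes "bin t"
  shows "t \<approx> binarize (normal_form r t)"
proof -
  have "t \<approx> binarize u \<and> schroeder_tree Q u" if "(contract r)\<^sup>*\<^sup>* t u" for u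
    using that
  proof (induction rule: rtranclp_induct)
    case base
    then show ?case
      using assms by (simp add: binarize_binary_tree schroeder_tree_binary assoc_equiv.refl)
  next
    case (step u v)
    then show ?case
      using binarize_contract schroeder_tree_contract assoc_equiv.trans by metis
  qed
  then show ?thesis using contract_rtranclp_normal_form by blast
qed

lemma contract_rtranclp_comb:
  fixes ts :: "'q ptree list"
  shows "a \<in> Q \<Longrightarrow> 2 \<le> length ts \<Longrightarrow> (contract r)\<^sup>*\<^sup>* (comb a ts) (Node a ts)"
proof (induction ts)
  case (Cons t ts)
  consider u where "ts = [u]" | "2 \<le> length ts"
    using Cons.prems(2) by (cases ts; cases "tl ts") auto
  then show ?case
  proof cases
    case 2
    then have "(contract r)\<^sup>*\<^sup>* (Node a ([t] @ [comb a ts])) (Node a ([t] @ [Node a ts]))"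
      using Cons by (intro contract_rtranclp_inside) auto
    \<comment> \<open>Equal labels contract to the same label, since
      \<open>m a a = a\<close>.\<close>
    also have "contract r (Node a ([t] @ [Node a ts])) (Node (m a a) ([t] @ ts @ []))"
      using Cons.prems by (intro contract.edge) (simp add: cmp_refl)
    finally show ?thesis using 2 by (cases "ts = []") (auto simp: comb_Cons poset_min_def)
  qed auto
qed simp

lemma contract_rtranclp_binarize: "schroeder_tree Q t \<Longrightarrow> (contract r)\<^sup>*\<^sup>* (binarize t) t"
proof (induction t)
  case (Node a ts)
  have "(contract r)\<^sup>*\<^sup>* (comb a (map binarize ts)) (Node a (map binarize ts))"
    using Node.prems by (intro contract_rtranclp_comb) auto
  also have "(contract r)\<^sup>*\<^sup>* \<dots> (Node a ts)"
    using contract_rtranclp_children[of ts r binarize a "[]"] Node by simp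
  finally show ?case by simp
qed simp

lemma normal_form_binarize:
  "schroeder_tree Q t \<Longrightarrow> alternating r t \<Longrightarrow> normal_form r (binarize t) = t"
  using normal_form_eqI[OF contract_rtranclp_binarize] normal_form_alternating by simp

end


section \<open>Quotients of operads\<close>

lemma carrier_scalars [simp]: "carrier scalars = UNIV"
  and mult_scalars [simp]: "a \<otimes>\<^bsub>scalars\<^esub> b = a * b"
  and one_scalars [simp]: "\<one>\<^bsub>scalars\<^esub> = 1"
  and zero_scalars [simp]: "\<zero>\<^bsub>scalars\<^esub> = 0"
  and add_scalars [simp]: "a \<oplus>\<^bsub>scalars\<^esub> b = a + b"
  by (simp_all add: scalars_def)

lemma cring_scalars: "cring (scalars :: 'k::field ring)"
proof (rule cringI)
  show "abelian_group (scalars :: 'k ring)"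
  proof (rule abelian_groupI)
    show "\<exists>y\<in>carrier scalars. y \<oplus>\<^bsub>scalars\<^esub> x = \<zero>\<^bsub>scalars\<^esub>" for x :: 'k
      by (intro bexI[of _ "- x"]) auto
  qed auto
  show "comm_monoid (scalars :: 'k ring)"
    by (rule comm_monoidI) (auto simp: mult.commute)
qed (auto simp: distrib_right)

text \<open>Every element of \<open>N\<close> is an image under \<open>\<beta>\<close>, so each
  module axiom is carried over from \<open>M\<close>. This replaces computations with sums of
  cosets.\<close>

lemma module_transport:
  fixes M :: "('k::field, 'a) module" and N :: "('k, 'b) module"
  assumes "module scalars M"
    and bij: "bij_betw \<beta> (carrier M) (carrier N)"
    and zero: "\<beta> \<zero>\<^bsub>M\<^esub> = \<zero>\<^bsub>N\<^esub>"
    and add: "\<And>x y. x \<in> carrier M \<Longrightarrow> y \<in> carrier M \<Longrightarrow> \<beta> (x \<oplus>\<^bsub>M\<^esub> y) = \<beta> x \<oplus>\<^bsub>N\<^esub> \<beta> y"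
    and smult: "\<And>c x. x \<in> carrier M \<Longrightarrow> \<beta> (c \<odot>\<^bsub>M\<^esub> x) = c \<odot>\<^bsub>N\<^esub> \<beta> x"
  shows "module scalars N"
proof -
  interpret M: module scalars M by fact
  have N: "carrier N = \<beta> ` carrier M" using bij by (simp add: bij_betw_def)
  show ?thesis
  proof (rule moduleI)
    show "cring (scalars :: 'k ring)" by (rule cring_scalars)
    show "abelian_group N"
    proof (rule abelian_groupI)
      show "\<zero>\<^bsub>N\<^esub> \<in> carrier N" unfolding N zero[symmetric] by auto
      show "\<exists>y\<in>carrier N. y \<oplus>\<^bsub>N\<^esub> x = \<zero>\<^bsub>N\<^esub>" if x: "x \<in> carrier N" for x
      proof -
        obtain x' where x': "x' \<in> carrier M" "x = \<beta> x'" using x N by auto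
        show ?thesis
          unfolding N using x' by (auto simp: add[symmetric] zero[symmetric] M.l_neg intro!: bexI[of _ "\<ominus>\<^bsub>M\<^esub> x'"])
      qed
    qed (auto simp: N add[symmetric] zero[symmetric] M.a_ac)
  qed (auto simp: N add[symmetric] smult[symmetric] M.smult_r_distr
      M.smult_l_distr[simplified] M.smult_assoc1[simplified] M.smult_one[simplified])
qed

text \<open>The map goes from the known operad \<open>R\<close> to \<open>S\<close>, because for a
  quotient it is simply the assignment of fibres; the isomorphism asked for is its inverse.\<close>

lemma operads_isomorphic_transport:
  fixes R :: "('k::field, 'b) ns_operad" and S :: "('k, 'a) ns_operad"
  assumes R: "ns_operad R"
    and bij: "\<And>n. bij_betw (\<beta> n) (elements R n) (elements S n)"
    and zero: "\<And>n. \<beta> n \<zero>\<^bsub>component R n\<^esub> = \<zero>\<^bsub>component S n\<^esub>"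
    and add: "\<And>n x y. x \<in> elements R n \<Longrightarrow> y \<in> elements R n \<Longrightarrow>
      \<beta> n (x \<oplus>\<^bsub>component R n\<^esub> y) = \<beta> n x \<oplus>\<^bsub>component S n\<^esub> \<beta> n y"
    and smult: "\<And>n c x. x \<in> elements R n \<Longrightarrow>
      \<beta> n (c \<odot>\<^bsub>component R n\<^esub> x) = c \<odot>\<^bsub>component S n\<^esub> \<beta> n x"
    and unit: "\<beta> 1 (ounit R) = ounit S"
    and pcomp: "\<And>m n i x y. \<lbrakk>x \<in> elements R m; y \<in> elements R n; 1 \<le> i; i \<le> m\<rbrakk> \<Longrightarrow>
      \<beta> (m + n - 1) (pcomp R m n i x y) = pcomp S m n i (\<beta> m x) (\<beta> n y)"
  shows "operads_isomorphic S R"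
proof -
  interpret R: ns_operad R by fact
  have S: "elements S n = \<beta> n ` elements R n" for n using bij by (simp add: bij_betw_def)
  have inv: "inv_into (elements R n) (\<beta> n) (\<beta> n x) = x" if "x \<in> elements R n" for n x
    using bij that by (meson bij_betw_inv_into_left)
  have closed: "x \<oplus>\<^bsub>component R n\<^esub> y \<in> elements R n" "c \<odot>\<^bsub>component R n\<^esub> x \<in> elements R n"
    if "x \<in> elements R n" "y \<in> elements R n" for n c x y
  proof -
    interpret module scalars "component R n" by (rule R.vector_space)
    show "x \<oplus>\<^bsub>component R n\<^esub> y \<in> elements R n" "c \<odot>\<^bsub>component R n\<^esub> x \<in> elements R n"
      using that by auto
  qed
  note hom = add[symmetric] smult[symmetric] pcomp[symmetric] unit[symmetric]
  have "ns_operad S"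
  proof (rule ns_operad.intro)
    show "module scalars (component S n)" for n
      using module_transport[OF R.vector_space bij] zero add smult by blast
    show "ounit S \<in> elements S 1" unfolding S unit[symmetric] using R.ounit_closed by blast
    show "pcomp S m n i x y \<in> elements S (m + n - 1)"
      if "x \<in> elements S m" "y \<in> elements S n" "1 \<le> i" "i \<le> m" for m n i x y
      using that R.pcomp_closed unfolding S by (auto simp: hom simp del: One_nat_def)
    show "pcomp S m n i (x \<oplus>\<^bsub>component S m\<^esub> x') y
        = pcomp S m n i x y \<oplus>\<^bsub>component S (m + n - 1)\<^esub> pcomp S m n i x' y"
      if "x \<in> elements S m" "x' \<in> elements S m" "y \<in> elements S n" "1 \<le> i" "i \<le> m"
      for m n i x x' y
      using that unfolding S by (auto simp: hom closed R.pcomp_closed R.pcomp_add_left simp del: One_nat_def)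
    show "pcomp S m n i x (y \<oplus>\<^bsub>component S n\<^esub> y')
        = pcomp S m n i x y \<oplus>\<^bsub>component S (m + n - 1)\<^esub> pcomp S m n i x y'"
      if "x \<in> elements S m" "y \<in> elements S n" "y' \<in> elements S n" "1 \<le> i" "i \<le> m"
      for m n i x y y'
      using that unfolding S by (auto simp: hom closed R.pcomp_closed R.pcomp_add_right simp del: One_nat_def)
    show "pcomp S m n i (c \<odot>\<^bsub>component S m\<^esub> x) y
        = c \<odot>\<^bsub>component S (m + n - 1)\<^esub> pcomp S m n i x y"
      if "x \<in> elements S m" "y \<in> elements S n" "1 \<le> i" "i \<le> m" for m n i c x y
      using that unfolding S by (auto simp: hom closed R.pcomp_closed R.pcomp_smult_left simp del: One_nat_def)
    show "pcomp S m n i x (c \<odot>\<^bsub>component S n\<^esub> y)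
        = c \<odot>\<^bsub>component S (m + n - 1)\<^esub> pcomp S m n i x y"
      if "x \<in> elements S m" "y \<in> elements S n" "1 \<le> i" "i \<le> m" for m n i c x y
      using that unfolding S by (auto simp: hom closed R.pcomp_closed R.pcomp_smult_right simp del: One_nat_def)
    show "pcomp S (l + m - 1) n (i + j - 1) (pcomp S l m i x y) z
        = pcomp S l (m + n - 1) i x (pcomp S m n j y z)"
      if xyz: "x \<in> elements S l" "y \<in> elements S m" "z \<in> elements S n"
        and ij: "1 \<le> i" "i \<le> l" "1 \<le> j" "j \<le> m" for l m n i j x y z
    proof -
      \<comment> \<open>Arities are arguments of \<open>pcomp\<close>, so the outer positions must
        be checked to be in range and the two total arities to agree.\<close>
      have ar: "1 \<le> i + j - 1" "i + j - 1 \<le> l + m - 1" "l + (m + n - 1) - 1 = l + m - 1 + n - 1"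
        using ij by auto
      obtain x' y' z' where "x = \<beta> l x'" "y = \<beta> m y'" "z = \<beta> n z'"
        and mem: "x' \<in> elements R l" "y' \<in> elements R m" "z' \<in> elements R n"
        using xyz unfolding S by auto
      then show ?thesis
        using R.pcomp_sequential[OF mem ij] pcomp[OF mem(1,2) ij(1,2)] pcomp[OF mem(2,3) ij(3,4)]
          pcomp[OF R.pcomp_closed[OF mem(1,2) ij(1,2)] mem(3) ar(1,2)]
          pcomp[OF mem(1) R.pcomp_closed[OF mem(2,3) ij(3,4)] ij(1,2)] ar(3)
        by simp
    qed
    show "pcomp S (l + m - 1) n (k + m - 1) (pcomp S l m i x y) z
        = pcomp S (l + n - 1) m i (pcomp S l n k x z) y"
      if xyz: "x \<in> elements S l" "y \<in> elements S m" "z \<in> elements S n"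
        and ik: "1 \<le> i" "i < k" "k \<le> l" for l m n i k x y z
    proof -
      have ar: "1 \<le> k + m - 1" "k + m - 1 \<le> l + m - 1" "1 \<le> i" "i \<le> l + n - 1"
        "1 \<le> k" "i \<le> l" "l + n - 1 + m - 1 = l + m - 1 + n - 1"
        using ik by auto
      obtain x' y' z' where "x = \<beta> l x'" "y = \<beta> m y'" "z = \<beta> n z'"
        and mem: "x' \<in> elements R l" "y' \<in> elements R m" "z' \<in> elements R n"
        using xyz unfolding S by auto
      then show ?thesis
        using R.pcomp_parallel[OF mem ik] pcomp[OF mem(1,2) ik(1) ar(6)] pcomp[OF mem(1,3) ar(5) ik(3)]
          pcomp[OF R.pcomp_closed[OF mem(1,2) ik(1) ar(6)] mem(3) ar(1,2)]
          pcomp[OF R.pcomp_closed[OF mem(1,3) ar(5) ik(3)] mem(2) ar(3,4)] ar(7)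
        by simp
    qed
    show "pcomp S 1 n 1 (ounit S) x = x" if x: "x \<in> elements S n" for n x
    proof -
      obtain x' where x: "x' \<in> elements R n" "x = \<beta> n x'" using x unfolding S by auto
      show ?thesis
        using pcomp[OF R.ounit_closed x(1), of 1] R.ounit_left[OF x(1)] x(2) unit by simp
    qed
    show "pcomp S m 1 i x (ounit S) = x" if x: "x \<in> elements S m" and i: "1 \<le> i" "i \<le> m" for m i x
    proof -
      obtain x' where x: "x' \<in> elements R m" "x = \<beta> m x'" using x unfolding S by auto
      show ?thesis
        using pcomp[OF x(1) R.ounit_closed i] R.ounit_right[OF x(1) i] x(2) unit
        by simp
    qed
  qed
  moreover have "(\<lambda>n. inv_into (elements R n) (\<beta> n)) \<in> operad_iso S R"
    unfolding operad_iso_def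
  proof (intro CollectI conjI allI ballI impI)
    show "bij_betw (inv_into (elements R n) (\<beta> n)) (elements S n) (elements R n)" for n
      using bij by (rule bij_betw_inv_into)
    show "inv_into (elements R 1) (\<beta> 1) (ounit S) = ounit R"
      using inv R.ounit_closed unit by metis
  next
    fix n x y assume "x \<in> elements S n" "y \<in> elements S n"
    then show "inv_into (elements R n) (\<beta> n) (x \<oplus>\<^bsub>component S n\<^esub> y) =
        inv_into (elements R n) (\<beta> n) x \<oplus>\<^bsub>component R n\<^esub> inv_into (elements R n) (\<beta> n) y"
      unfolding S by (auto simp: hom inv closed simp del: One_nat_def)
  next
    fix n c x assume "x \<in> elements S n"
    then show "inv_into (elements R n) (\<beta> n) (c \<odot>\<^bsub>component S n\<^esub> x) =
        c \<odot>\<^bsub>component R n\<^esub> inv_into (elements R n) (\<beta> n) x"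
      unfolding S by (auto simp: hom inv closed simp del: One_nat_def)
  next
    fix m n i x y assume "x \<in> elements S m" "y \<in> elements S n" "1 \<le> i \<and> i \<le> m"
    then show "inv_into (elements R (m + n - 1)) (\<beta> (m + n - 1)) (pcomp S m n i x y) =
        pcomp R m n i (inv_into (elements R m) (\<beta> m) x) (inv_into (elements R n) (\<beta> n) y)"
      unfolding S by (auto simp: hom inv R.pcomp_closed simp del: One_nat_def)
  qed
  ultimately show ?thesis unfolding operads_isomorphic_def using R by blast
qed

lemma set_add_def': "set_add M H K = (\<Union>h\<in>H. \<Union>k\<in>K. {h \<oplus>\<^bsub>M\<^esub> k})"
  by (simp add: set_add_def set_mult_def)

text \<open>The first isomorphism theorem for operads. The axioms of the quotient are obtained by
  transport from \<open>R\<close>.\<close>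

theorem quotient_operad_isomorphic:
  fixes P :: "('k::field, 'a) ns_operad" and R :: "('k, 'b) ns_operad"
  assumes P: "ns_operad P" and R: "ns_operad R"
    and surj: "\<And>n. \<phi> n ` elements P n = elements R n"
    and add: "\<And>n x y. x \<in> elements P n \<Longrightarrow> y \<in> elements P n \<Longrightarrow>
      \<phi> n (x \<oplus>\<^bsub>component P n\<^esub> y) = \<phi> n x \<oplus>\<^bsub>component R n\<^esub> \<phi> n y"
    and smult: "\<And>n c x. x \<in> elements P n \<Longrightarrow>
      \<phi> n (c \<odot>\<^bsub>component P n\<^esub> x) = c \<odot>\<^bsub>component R n\<^esub> \<phi> n x"
    and unit: "\<phi> 1 (ounit P) = ounit R"
    and pcomp: "\<And>m n i x y. \<lbrakk>x \<in> elements P m; y \<in> elements P n; 1 \<le> i; i \<le> m\<rbrakk> \<Longrightarrow>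
      \<phi> (m + n - 1) (pcomp P m n i x y) = pcomp R m n i (\<phi> m x) (\<phi> n y)"
    and kernel: "\<And>n. I n = {x \<in> elements P n. \<phi> n x = \<zero>\<^bsub>component R n\<^esub>}"
  shows "operads_isomorphic (quotient_operad P I) R"
proof -
  interpret P: ns_operad P by fact
  interpret R: ns_operad R by fact
  interpret PM: module scalars "component P n" for n by (rule P.vector_space)
  interpret RM: module scalars "component R n" for n by (rule R.vector_space)
  define fib where "fib n z = {x \<in> elements P n. \<phi> n x = z}" for n z
  have mem_R: "\<phi> n x \<in> elements R n" if "x \<in> elements P n" for n x
    using surj that by blast
  have nonempty: "\<exists>x\<in>elements P n. \<phi> n x = z" if "z \<in> elements R n" for n z
    using that unfolding surj[symmetric] by blast
  \<comment> \<open>The cosets are the fibres of the morphism, so the quotient is a copy of its target.\<close>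
  have coset: "I n +>\<^bsub>component P n\<^esub> x = fib n (\<phi> n x)" if "x \<in> elements P n" for n x
  proof (intro equalityI subsetI)
    fix y assume "y \<in> I n +>\<^bsub>component P n\<^esub> x"
    then show "y \<in> fib n (\<phi> n x)"
      using that mem_R by (auto simp: a_r_coset_def' kernel fib_def add)
  next
    fix y assume y: "y \<in> fib n (\<phi> n x)"
    let ?h = "y \<ominus>\<^bsub>component P n\<^esub> x"
    have y': "y \<in> elements P n" "\<phi> n y = \<phi> n x" using y by (auto simp: fib_def)
    have yh: "y = ?h \<oplus>\<^bsub>component P n\<^esub> x"
      using y'(1) that by (simp add: PM.minus_eq PM.a_assoc PM.l_neg)
    \<comment> \<open>Cancelling \<open>\<phi> n x\<close> shows that the difference lies in the
      kernel.\<close>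
    have "\<phi> n ?h \<oplus>\<^bsub>component R n\<^esub> \<phi> n x = \<phi> n x"
      using add[of ?h n x] yh y' that by simp
    then have "?h \<in> I n"
      using y'(1) that mem_R by (simp add: kernel)
    then show "y \<in> I n +>\<^bsub>component P n\<^esub> x"
      using yh unfolding a_r_coset_def' by blast
  qed
  let ?S = "quotient_operad P I"
  have S: "elements ?S n = fib n ` elements R n" for n
    by (auto simp: quotient_operad_def quotient_module_def A_RCOSETS_def RCOSETS_def
        a_r_coset_def[symmetric] coset surj[symmetric])
  \<comment> \<open>The operations of the quotient are unions over representatives. All members of
    such a union agree, and nonempty fibres keep it from being empty.\<close>
  have fib_eq: "(\<Union>x\<in>fib m u. \<Union>y\<in>fib n v. f x y) = fib k w"
    if "u \<in> elements R m" "v \<in> elements R n"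
      and "\<And>x y. x \<in> fib m u \<Longrightarrow> y \<in> fib n v \<Longrightarrow> f x y = fib k w" for f m n k u v w
    using that nonempty[of u m] nonempty[of v n] by (fastforce simp: fib_def)
  show ?thesis
  proof (rule operads_isomorphic_transport[where \<beta> = fib, OF R])
    fix n
    have "inj_on (fib n) (elements R n)"
      using nonempty by (intro inj_onI) (fastforce simp: fib_def)
    then show "bij_betw (fib n) (elements R n) (elements ?S n)"
      by (simp add: bij_betw_def S)
    show "fib n \<zero>\<^bsub>component R n\<^esub> = \<zero>\<^bsub>component ?S n\<^esub>"
      by (simp add: quotient_operad_def quotient_module_def kernel fib_def)
  next
    fix n u v assume u: "u \<in> elements R n" and v: "v \<in> elements R n"
    obtain x where x: "x \<in> elements P n" "\<phi> n x = u" using nonempty[OF u] by blast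
    have "set_add (component P n) (fib n u) (fib n v) = fib n (u \<oplus>\<^bsub>component R n\<^esub> v)"
    proof (intro equalityI subsetI)
      fix z assume "z \<in> set_add (component P n) (fib n u) (fib n v)"
      then show "z \<in> fib n (u \<oplus>\<^bsub>component R n\<^esub> v)" by (auto simp: set_add_def' fib_def add)
    next
      fix z assume "z \<in> fib n (u \<oplus>\<^bsub>component R n\<^esub> v)"
      then have z: "z \<in> elements P n" "\<phi> n z = u \<oplus>\<^bsub>component R n\<^esub> v" by (auto simp: fib_def)
      \<comment> \<open>An element over the sum splits as the chosen \<open>x\<close> over
        \<open>u\<close> plus a remainder, which lies over \<open>v\<close> by cancellation.\<close>
      let ?y = "\<ominus>\<^bsub>component P n\<^esub> x \<oplus>\<^bsub>component P n\<^esub> z"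
      have xy: "x \<oplus>\<^bsub>component P n\<^esub> ?y = z" using x(1) z(1) PM.r_neg2 by simp
      have "u \<oplus>\<^bsub>component R n\<^esub> \<phi> n ?y = u \<oplus>\<^bsub>component R n\<^esub> v"
        using add[of x n ?y] x z xy by simp
      then have "?y \<in> fib n v"
        using u v x z mem_R[of ?y n] by (simp add: fib_def)
      then show "z \<in> set_add (component P n) (fib n u) (fib n v)"
        using x xy unfolding set_add_def' by (force simp: fib_def)
    qed
    then show "fib n (u \<oplus>\<^bsub>component R n\<^esub> v) = fib n u \<oplus>\<^bsub>component ?S n\<^esub> fib n v"
      by (simp add: quotient_operad_def quotient_module_def)
  next
    fix n c u assume u: "u \<in> elements R n"
    \<comment> \<open>The rule for two representatives is used with a dummy second one, again from
      the fibre of \<open>u\<close>.\<close>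
    have "(\<Union>x\<in>fib n u. I n +>\<^bsub>component P n\<^esub> (c \<odot>\<^bsub>component P n\<^esub> x)) = fib n (c \<odot>\<^bsub>component R n\<^esub> u)"
      using fib_eq[OF u u, of "\<lambda>x y. I n +>\<^bsub>component P n\<^esub> (c \<odot>\<^bsub>component P n\<^esub> x)"] nonempty[OF u]
      by (auto simp: fib_def coset smult)
    then show "fib n (c \<odot>\<^bsub>component R n\<^esub> u) = c \<odot>\<^bsub>component ?S n\<^esub> fib n u"
      by (simp add: quotient_operad_def quotient_module_def)
  next
    show "fib 1 (ounit R) = ounit ?S"
      using P.ounit_closed unit by (simp add: quotient_operad_def coset)
  next
    fix m n i u v assume "u \<in> elements R m" "v \<in> elements R n" "1 \<le> i" "i \<le> m"
    then show "fib (m + n - 1) (pcomp R m n i u v) = pcomp ?S m n i (fib m u) (fib n v)"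
      unfolding quotient_operad_def ns_operad.simps
      by (intro fib_eq[symmetric]) (auto simp: fib_def coset P.pcomp_closed[simplified] pcomp[simplified])
  qed
qed


section \<open>Operads of trees\<close>

abbreviation scale :: "'k::field \<Rightarrow> ('a \<Rightarrow>\<^sub>0 'k) \<Rightarrow> 'a \<Rightarrow>\<^sub>0 'k" where
  "scale c \<equiv> Poly_Mapping.map ((*) c)"

lemma lookup_scale [simp]: "Poly_Mapping.lookup (scale c p) k = c * Poly_Mapping.lookup p k"
  by (simp add: Poly_Mapping.map.rep_eq when_def)

lemma keys_scale: "Poly_Mapping.keys (scale c p) \<subseteq> Poly_Mapping.keys p"
  by (auto simp: in_keys_iff)

lemma scale_simps:
  "scale c (p + q) = scale c p + scale c q"
  "scale (a + b) p = scale a p + scale b p"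
  "scale a (scale b p) = scale (a * b) p"
  "scale 1 p = p"
  "scale 0 p = 0"
  "scale c 0 = 0"
  by (auto intro!: poly_mapping_eqI simp: lookup_add algebra_simps)

lemma scale_diff: "scale c (p - q) = scale c p - scale c q"
  by (rule poly_mapping_eqI) (simp add: lookup_minus algebra_simps)

lemma scale_single: "scale c (Poly_Mapping.single s a) = Poly_Mapping.single s (c * a)"
  by simp

lemma scale_sum: "scale c (sum f S) = (\<Sum>s\<in>S. scale c (f s))"
  by (rule poly_mapping_eqI) (simp add: lookup_sum sum_distrib_left)

text \<open>Here \<open>h s a\<close> is the contribution of a basis element \<open>s\<close> with
  coefficient \<open>a\<close>. Linear and bilinear extensions both have this shape.\<close>

definition scalar_sum :: "('a \<Rightarrow> 'k::field \<Rightarrow> 'b::comm_monoid_add) \<Rightarrow> ('a \<Rightarrow>\<^sub>0 'k) \<Rightarrow> 'b" where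
  "scalar_sum h p = (\<Sum>s\<in>Poly_Mapping.keys p. h s (Poly_Mapping.lookup p s))"

lemma scalar_sum_0 [simp]: "scalar_sum h 0 = 0"
  by (simp add: scalar_sum_def)

lemma scalar_sum_single: "h s 0 = 0 \<Longrightarrow> scalar_sum h (Poly_Mapping.single s a) = h s a"
  by (simp add: scalar_sum_def)

text \<open>Cancellation may shrink the support of \<open>p + q\<close>; the condition at
  coefficient 0 makes the missing terms vanish.\<close>

lemma scalar_sum_add:
  "(\<And>s. h s 0 = 0) \<Longrightarrow> (\<And>s a b. h s (a + b) = h s a + h s b) \<Longrightarrow>
    scalar_sum h (p + q) = scalar_sum h p + scalar_sum h q"
  unfolding scalar_sum_def by (rule setsum_keys_plus_distrib)

lemma scalar_sum_scale:
  "(\<And>s. h s 0 = 0) \<Longrightarrow> scalar_sum h (scale c p) = scalar_sum (\<lambda>s a. h s (c * a)) p"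
  unfolding scalar_sum_def lookup_scale using keys_scale
  by (intro sum.mono_neutral_cong_left) (auto simp: in_keys_iff)

lemma scale_scalar_sum: "scale c (scalar_sum h p) = scalar_sum (\<lambda>s a. scale c (h s a)) p"
  by (simp add: scalar_sum_def scale_sum)

lemma scalar_sum_distrib:
  "scalar_sum (\<lambda>s a. h s a + h' s a) p = scalar_sum h p + scalar_sum h' p"
  by (simp add: scalar_sum_def sum.distrib)

definition linear_extension :: "('a \<Rightarrow> 'b) \<Rightarrow> ('a \<Rightarrow>\<^sub>0 'k::field) \<Rightarrow> 'b \<Rightarrow>\<^sub>0 'k" where
  "linear_extension f = scalar_sum (\<lambda>s. Poly_Mapping.single (f s))"

text \<open>Nested so that linearity in \<open>q\<close> is inherited from
  \<open>linear_extension\<close>; \<open>tree_operad_simps\<close> identifies it with the double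
  sum in \<open>tree_operad\<close>.\<close>

definition bilinear_extension ::
    "('a \<Rightarrow> 'b \<Rightarrow> 'c) \<Rightarrow> ('a \<Rightarrow>\<^sub>0 'k::field) \<Rightarrow> ('b \<Rightarrow>\<^sub>0 'k) \<Rightarrow> 'c \<Rightarrow>\<^sub>0 'k" where
  "bilinear_extension f p q = scalar_sum (\<lambda>s a. scale a (linear_extension (f s) q)) p"

lemma linear_extension_simps [simp]:
  "linear_extension f 0 = 0"
  "linear_extension f (Poly_Mapping.single s a) = Poly_Mapping.single (f s) a"
  "linear_extension f (p + q) = linear_extension f p + linear_extension f q"
  "linear_extension f (scale c p) = scale c (linear_extension f p)"
  by (simp_all add: linear_extension_def scalar_sum_single scalar_sum_add single_add scalar_sum_scale
      scale_scalar_sum)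

lemma bilinear_extension_simps [simp]:
  "bilinear_extension f 0 q = 0"
  "bilinear_extension f p 0 = 0"
  "bilinear_extension f (Poly_Mapping.single s a) (Poly_Mapping.single t b)
    = Poly_Mapping.single (f s t) (a * b)"
  "bilinear_extension f (p + p') q = bilinear_extension f p q + bilinear_extension f p' q"
  "bilinear_extension f p (q + q') = bilinear_extension f p q + bilinear_extension f p q'"
  "bilinear_extension f (scale c p) q = scale c (bilinear_extension f p q)"
  "bilinear_extension f p (scale c q) = scale c (bilinear_extension f p q)"
proof -
  show "bilinear_extension f p 0 = 0" by (simp add: bilinear_extension_def scalar_sum_def scale_simps)
qed (simp_all add: bilinear_extension_def scalar_sum_single scalar_sum_add scale_simps scalar_sum_scale
      scale_scalar_sum scalar_sum_distrib mult.commute)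

lemma keys_linear_extension:
  "Poly_Mapping.keys (linear_extension f p) \<subseteq> f ` Poly_Mapping.keys p"
proof -
  have "Poly_Mapping.keys (linear_extension f p) \<subseteq>
      (\<Union>s\<in>Poly_Mapping.keys p. Poly_Mapping.keys (Poly_Mapping.single (f s) (Poly_Mapping.lookup p s)))"
    unfolding linear_extension_def scalar_sum_def by (rule keys_sum)
  then show ?thesis by (fastforce split: if_splits)
qed

lemma keys_bilinear_extension:
  assumes "\<And>s t. s \<in> Poly_Mapping.keys p \<Longrightarrow> t \<in> Poly_Mapping.keys q \<Longrightarrow> f s t \<in> C"
  shows "Poly_Mapping.keys (bilinear_extension f p q) \<subseteq> C"
proof -
  have "Poly_Mapping.keys (scale a (linear_extension (f s) q)) \<subseteq> C"
    if "s \<in> Poly_Mapping.keys p" for s a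
    using that assms keys_scale[of a "linear_extension (f s) q"] keys_linear_extension[of "f s" q] by blast
  then show ?thesis
    unfolding bilinear_extension_def scalar_sum_def by (intro order.trans[OF keys_sum] UN_least)
qed

text \<open>Reduces identities that are additive in \<open>p\<close> to single basis
  elements.\<close>

lemma poly_mapping_span_induct [consumes 1, case_names zero single add]:
  fixes p :: "'a \<Rightarrow>\<^sub>0 'b::comm_monoid_add"
  assumes "Poly_Mapping.keys p \<subseteq> B"
    and zero: "P 0"
    and single: "\<And>s a. s \<in> B \<Longrightarrow> P (Poly_Mapping.single s a)"
    and add: "\<And>p q. \<lbrakk>Poly_Mapping.keys p \<subseteq> B; Poly_Mapping.keys q \<subseteq> B; P p; P q\<rbrakk> \<Longrightarrow> P (p + q)"
  shows "P p"
proof -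
  let ?g = "\<lambda>s. Poly_Mapping.single s (Poly_Mapping.lookup p s)"
  have eq: "p = (\<Sum>s\<in>Poly_Mapping.keys p. ?g s)"
    by (rule poly_mapping_eqI) (auto simp: lookup_sum lookup_single when_def in_keys_iff)
  \<comment> \<open>The bound on the support joins the claim because the case \<open>add\<close>
    asks for it.\<close>
  have "P (\<Sum>s\<in>S. ?g s) \<and> Poly_Mapping.keys (\<Sum>s\<in>S. ?g s) \<subseteq> B" if "finite S" "S \<subseteq> B" for S
    using that
  proof (induction S)
    case (insert s S)
    then have "Poly_Mapping.keys (?g s) \<subseteq> B" by simp
    then show ?case
      using insert single[of s] add[of "?g s" "\<Sum>s\<in>S. ?g s"] keys_add[of "?g s" "\<Sum>s\<in>S. ?g s"] by auto
  qed (simp add: zero)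
  then show ?thesis using assms(1) eq by (metis finite_keys)
qed

section \<open>Operads obtained by linearising a composition of trees\<close>

lemma tree_space_simps [simp]:
  "carrier (tree_space B n) = {p. Poly_Mapping.keys p \<subseteq> {t \<in> B. leaves t = n}}"
  "zero (tree_space B n) = 0"
  "add (tree_space B n) = (+)"
  "smult (tree_space B n) = scale"
  by (simp_all add: tree_space_def)

lemma module_tree_space: "module scalars (tree_space B n :: ('k::field, 'q ptree \<Rightarrow>\<^sub>0 'k) module)"
proof (rule moduleI)
  show "cring (scalars :: 'k ring)" by (rule cring_scalars)
  show "abelian_group (tree_space B n :: ('k, 'q ptree \<Rightarrow>\<^sub>0 'k) module)"
  proof (rule abelian_groupI)
    fix p q :: "'q ptree \<Rightarrow>\<^sub>0 'k"
    assume p: "p \<in> carrier (tree_space B n)"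
    then show "\<exists>q\<in>carrier (tree_space B n). q \<oplus>\<^bsub>tree_space B n\<^esub> p = \<zero>\<^bsub>tree_space B n\<^esub>"
      by (intro bexI[of _ "- p"]) auto
    assume "q \<in> carrier (tree_space B n)"
    with p show "p \<oplus>\<^bsub>tree_space B n\<^esub> q \<in> carrier (tree_space B n)"
      using keys_add[of p q] by auto
  qed (auto simp: add_ac)
next
  fix c :: 'k and p :: "'q ptree \<Rightarrow>\<^sub>0 'k"
  assume "p \<in> carrier (tree_space B n)"
  then show "c \<odot>\<^bsub>tree_space B n\<^esub> p \<in> carrier (tree_space B n)"
    using keys_scale[of c p] by auto
qed (auto simp: scale_simps)

lemma tree_operad_simps [simp]:
  "component (tree_operad B f) = tree_space B"
  "pcomp (tree_operad B f) m n i = bilinear_extension (\<lambda>s t. f s i t)"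
  "ounit (tree_operad B f) = Poly_Mapping.single Leaf 1"
  by (auto simp: tree_operad_def bilinear_extension_def linear_extension_def scalar_sum_def
      scale_sum scale_single fun_eq_iff)

text \<open>A nonsymmetric operad in sets, graded by leaves, with its axioms stated for trees in
  \<open>B\<close> and positions in range only.\<close>

locale tree_composition =
  fixes B :: "'q ptree set" and f :: "'q ptree \<Rightarrow> nat \<Rightarrow> 'q ptree \<Rightarrow> 'q ptree"
  assumes Leaf: "Leaf \<in> B"
    and closed: "\<lbrakk>s \<in> B; t \<in> B; 1 \<le> i; i \<le> leaves s\<rbrakk> \<Longrightarrow>
      f s i t \<in> B \<and> leaves (f s i t) = leaves s + leaves t - 1"
    and sequential: "\<lbrakk>s \<in> B; t \<in> B; u \<in> B; 1 \<le> i; i \<le> leaves s; 1 \<le> j; j \<le> leaves t\<rbrakk> \<Longrightarrow>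
      f (f s i t) (i + j - 1) u = f s i (f t j u)"
    and parallel: "\<lbrakk>s \<in> B; t \<in> B; u \<in> B; 1 \<le> i; i < k; k \<le> leaves s\<rbrakk> \<Longrightarrow>
      f (f s i t) (k + leaves t - 1) u = f (f s k u) i t"
    and Leaf_left: "t \<in> B \<Longrightarrow> f Leaf 1 t = t"
    and Leaf_right: "\<lbrakk>s \<in> B; 1 \<le> i; i \<le> leaves s\<rbrakk> \<Longrightarrow> f s i Leaf = s"
begin

text \<open>Both sides of each associativity axiom are linear in every argument, so nested
  inductions reduce it to basis trees.\<close>

theorem ns_operad: "ns_operad (tree_operad B f :: ('k::field, 'q ptree \<Rightarrow>\<^sub>0 'k) ns_operad)"
proof (rule ns_operad.intro, unfold tree_operad_simps tree_space_simps mem_Collect_eq)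
  show "module scalars (tree_space B n :: ('k, 'q ptree \<Rightarrow>\<^sub>0 'k) module)" for n
    by (rule module_tree_space)
  show "Poly_Mapping.keys (Poly_Mapping.single Leaf (1 :: 'k)) \<subseteq> {t \<in> B. leaves t = 1}"
    by (simp add: Leaf)
next
  fix x y :: "'q ptree \<Rightarrow>\<^sub>0 'k" and m n i
  assume "Poly_Mapping.keys x \<subseteq> {t \<in> B. leaves t = m}" "Poly_Mapping.keys y \<subseteq> {t \<in> B. leaves t = n}"
    "1 \<le> i" "i \<le> m"
  then show "Poly_Mapping.keys (bilinear_extension (\<lambda>s. f s i) x y) \<subseteq> {t \<in> B. leaves t = m + n - 1}"
    using closed by (intro keys_bilinear_extension) fastforce
next
  fix x y z :: "'q ptree \<Rightarrow>\<^sub>0 'k" and l m n i j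
  assume x: "Poly_Mapping.keys x \<subseteq> {t \<in> B. leaves t = l}"
    and y: "Poly_Mapping.keys y \<subseteq> {t \<in> B. leaves t = m}"
    and z: "Poly_Mapping.keys z \<subseteq> {t \<in> B. leaves t = n}"
    and ij: "1 \<le> i" "i \<le> l" "1 \<le> j" "j \<le> m"
  show "bilinear_extension (\<lambda>s. f s (i + j - 1)) (bilinear_extension (\<lambda>s. f s i) x y) z
      = bilinear_extension (\<lambda>s. f s i) x (bilinear_extension (\<lambda>s. f s j) y z)"
    using x
  proof (induction x rule: poly_mapping_span_induct)
    case s: (single s a)
    show ?case using y
    proof (induction y rule: poly_mapping_span_induct)
      case t: (single t b)
      show ?case using z
      proof (induction z rule: poly_mapping_span_induct)
        case (single u c)
        then show ?case using s t ij sequential[of s t u i j] by (auto simp: mult.assoc)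
      qed auto
    qed auto
  qed auto
next
  fix x y z :: "'q ptree \<Rightarrow>\<^sub>0 'k" and l m n i k
  assume x: "Poly_Mapping.keys x \<subseteq> {t \<in> B. leaves t = l}"
    and y: "Poly_Mapping.keys y \<subseteq> {t \<in> B. leaves t = m}"
    and z: "Poly_Mapping.keys z \<subseteq> {t \<in> B. leaves t = n}"
    and ik: "1 \<le> i" "i < k" "k \<le> l"
  show "bilinear_extension (\<lambda>s. f s (k + m - 1)) (bilinear_extension (\<lambda>s. f s i) x y) z
      = bilinear_extension (\<lambda>s. f s i) (bilinear_extension (\<lambda>s. f s k) x z) y"
    using x
  proof (induction x rule: poly_mapping_span_induct)
    case s: (single s a)
    show ?case using y
    proof (induction y rule: poly_mapping_span_induct)
      case t: (single t b)
      show ?case using z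
      proof (induction z rule: poly_mapping_span_induct)
        case (single u c)
        then show ?case using s t ik parallel[of s t u i k] by (auto simp: mult_ac)
      qed auto
    qed auto
  qed auto
next
  fix x :: "'q ptree \<Rightarrow>\<^sub>0 'k" and n
  assume "Poly_Mapping.keys x \<subseteq> {t \<in> B. leaves t = n}"
  then show "bilinear_extension (\<lambda>s. f s 1) (Poly_Mapping.single Leaf 1) x = x"
    by (induction x rule: poly_mapping_span_induct) (auto simp: Leaf_left[simplified])
next
  fix x :: "'q ptree \<Rightarrow>\<^sub>0 'k" and m i
  assume "Poly_Mapping.keys x \<subseteq> {t \<in> B. leaves t = m}" "1 \<le> i" "i \<le> m"
  then show "bilinear_extension (\<lambda>s. f s i) x (Poly_Mapping.single Leaf 1) = x"
    by (induction x rule: poly_mapping_span_induct) (auto simp: Leaf_right[simplified])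
qed (auto simp del: One_nat_def)

end

lemma linear_extension_diff:
  "linear_extension f (p - q) = linear_extension f p - linear_extension f q"
  using linear_extension_simps(3)[of f "p - q" q] by (simp add: algebra_simps)

lemma bilinear_extension_diff:
  "bilinear_extension f (p - p') q = bilinear_extension f p q - bilinear_extension f p' q"
  "bilinear_extension f p (q - q') = bilinear_extension f p q - bilinear_extension f p q'"
  using bilinear_extension_simps(4)[of f "p - p'" p' q] bilinear_extension_simps(5)[of f p "q - q'" q']
  by (simp_all add: algebra_simps)

lemma linear_extension_comp:
  "linear_extension g (linear_extension f p) = linear_extension (g \<circ> f) p"
proof -
  have "Poly_Mapping.keys p \<subseteq> UNIV" by simp
  then show ?thesis by (induction p rule: poly_mapping_span_induct) auto
qed

lemma linear_extension_ident:
  assumes "\<And>s. s \<in> Poly_Mapping.keys p \<Longrightarrow> f s = s"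
  shows "linear_extension f p = p"
  using subset_refl[of "Poly_Mapping.keys p"]
  by (induction p rule: poly_mapping_span_induct) (auto simp: assms)

lemma linear_extension_bilinear_extension:
  assumes "Poly_Mapping.keys p \<subseteq> B" "Poly_Mapping.keys q \<subseteq> C"
    and hom: "\<And>s t. s \<in> B \<Longrightarrow> t \<in> C \<Longrightarrow> h (f s t) = g (h s) (h t)"
  shows "linear_extension h (bilinear_extension f p q)
    = bilinear_extension g (linear_extension h p) (linear_extension h q)"
  using assms(1)
proof (induction p rule: poly_mapping_span_induct)
  case s: (single s a)
  show ?case using assms(2)
    by (induction q rule: poly_mapping_span_induct) (use s in \<open>auto simp: hom\<close>)
qed auto

lemma tree_composition_graft: "Leaf \<in> B \<Longrightarrow>
    (\<And>s i t. s \<in> B \<Longrightarrow> t \<in> B \<Longrightarrow> graft s i t \<in> B) \<Longrightarrow> tree_composition B graft"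
  by unfold_locales (auto simp: leaves_graft graft_sequential[simplified] graft_parallel[simplified])

text \<open>Inner normal forms are removed by \<open>normal_form_graft_left\<close> and
  \<open>normal_form_graft_right\<close>; what remains is the associativity of plain
  grafting.\<close>

lemma (in forest) tree_composition_normal_form:
  "tree_composition {t. schroeder_tree Q t \<and> alternating r t} (\<lambda>s i t. normal_form r (graft s i t))"
proof unfold_locales
  fix s t u i j
  let ?B = "{t. schroeder_tree Q t \<and> alternating r t}"
  assume B: "s \<in> ?B" "t \<in> ?B" "u \<in> ?B" and "1 \<le> i" "i \<le> leaves s" "1 \<le> j" "j \<le> leaves t"
  then show "normal_form r (graft (normal_form r (graft s i t)) (i + j - 1) u)
      = normal_form r (graft s i (normal_form r (graft t j u)))"
    by (subst normal_form_graft_left)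
      (auto simp: normal_form_graft_right leaves_graft graft_sequential[simplified])
next
  fix s t u i k
  let ?B = "{t. schroeder_tree Q t \<and> alternating r t}"
  assume B: "s \<in> ?B" "t \<in> ?B" "u \<in> ?B" and ik: "1 \<le> i" "i < k" "k \<le> leaves s"
  then have "1 \<le> leaves t" "1 \<le> leaves u" using schroeder_tree_leaves_pos by blast+
  then show "normal_form r (graft (normal_form r (graft s i t)) (k + leaves t - 1) u)
      = normal_form r (graft (normal_form r (graft s k u)) i t)"
    using ik by (subst (1 2) normal_form_graft_left)
      (auto simp: leaves_graft graft_parallel[simplified])
qed (auto simp: schroeder_tree_normal_form alternating_normal_form schroeder_tree_graft leaves_graft
    normal_form_alternating)


section \<open>The isomorphism\<close>

lemma tree_operad_ideal_closed:
  assumes "operad_ideal (tree_operad B f) I"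
  shows "0 \<in> I n"
    and "p \<in> I n \<Longrightarrow> q \<in> I n \<Longrightarrow> p + q \<in> I n"
    and "p \<in> I n \<Longrightarrow> scale c p \<in> I n"
    and "p \<in> I n \<Longrightarrow> q \<in> I n \<Longrightarrow> p - q \<in> I n"
proof -
  interpret I: submodule "I n" scalars "tree_space B n"
    using assms by (simp add: operad_ideal_def)
  show "0 \<in> I n" using I.one_closed by simp
  show add: "p + q \<in> I n" if "p \<in> I n" "q \<in> I n" for p q using I.m_closed[OF that] by simp
  show scale: "scale c p \<in> I n" if "p \<in> I n" for c p using I.smult_closed[OF _ that, of c] by simp
  have "p - q = p + scale (-1) q" by (rule poly_mapping_eqI) (simp add: lookup_add lookup_minus)
  then show "p - q \<in> I n" if "p \<in> I n" "q \<in> I n" using that add scale by metis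
qed

lemma free_binary_eq: "free_binary Q = tree_operad {t. binary_tree Q t} graft"
  by (simp add: free_binary_def free_operad_def)

lemma ns_operad_free_binary: "ns_operad (free_binary Q :: ('k::field, 'q ptree \<Rightarrow>\<^sub>0 'k) ns_operad)"
  unfolding free_binary_eq
  by (intro tree_composition.ns_operad tree_composition_graft) (auto intro: syntax_tree_graft)

text \<open>Equal leaf counts make the difference homogeneous, so that \<open>leaves s\<close>
  selects the right component of the ideal.\<close>

definition congruent_mod :: "(nat \<Rightarrow> ('q ptree \<Rightarrow>\<^sub>0 'k::field) set) \<Rightarrow> 'q ptree \<Rightarrow> 'q ptree \<Rightarrow> bool" where
  "congruent_mod I s t \<longleftrightarrow> leaves s = leaves t \<and>
    Poly_Mapping.single s 1 - Poly_Mapping.single t 1 \<in> I (leaves s)"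

context
  fixes Q :: "'q set" and I :: "nat \<Rightarrow> ('q ptree \<Rightarrow>\<^sub>0 'k::field) set"
  assumes ideal: "operad_ideal (free_binary Q) I"
begin

lemmas free_binary_ideal_closed = tree_operad_ideal_closed[OF ideal[unfolded free_binary_eq]]

lemma congruent_mod_sym: "congruent_mod I s t \<Longrightarrow> congruent_mod I t s"
  using free_binary_ideal_closed(4)[OF free_binary_ideal_closed(1)] unfolding congruent_mod_def by (metis diff_0 minus_diff_eq)

lemma congruent_mod_trans: "congruent_mod I s t \<Longrightarrow> congruent_mod I t u \<Longrightarrow> congruent_mod I s u"
  using free_binary_ideal_closed(2)[of "Poly_Mapping.single s 1 - Poly_Mapping.single t 1" "leaves s"
      "Poly_Mapping.single t 1 - Poly_Mapping.single u 1"]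
  unfolding congruent_mod_def by auto

lemma congruent_mod_graft_left:
  assumes "congruent_mod I s s'" "binary_tree Q t" "1 \<le> i" "i \<le> leaves s"
  shows "congruent_mod I (graft s i t) (graft s' i t)"
proof -
  let ?d = "Poly_Mapping.single s 1 - Poly_Mapping.single s' (1 :: 'k)"
  have d: "?d \<in> I (leaves s)" "leaves s = leaves s'" using assms(1) by (auto simp: congruent_mod_def)
  have t: "Poly_Mapping.single t 1 \<in> elements (free_binary Q) (leaves t)"
    using assms(2) by (simp add: free_binary_eq)
  have "pcomp (free_binary Q) (leaves s) (leaves t) i ?d (Poly_Mapping.single t 1)
      \<in> I (leaves s + leaves t - 1)"
    using ideal d(1) t assms(3,4) unfolding operad_ideal_def by blast
  then show ?thesis
    using assms(3,4) d(2) by (simp add: congruent_mod_def free_binary_eq bilinear_extension_diff leaves_graft)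
qed

lemma congruent_mod_graft_right:
  assumes "congruent_mod I t t'" "binary_tree Q s" "1 \<le> i" "i \<le> leaves s"
  shows "congruent_mod I (graft s i t) (graft s i t')"
proof -
  let ?d = "Poly_Mapping.single t 1 - Poly_Mapping.single t' (1 :: 'k)"
  have d: "?d \<in> I (leaves t)" "leaves t = leaves t'" using assms(1) by (auto simp: congruent_mod_def)
  have s: "Poly_Mapping.single s 1 \<in> elements (free_binary Q) (leaves s)"
    using assms(2) by (simp add: free_binary_eq)
  have "pcomp (free_binary Q) (leaves s) (leaves t) i (Poly_Mapping.single s 1) ?d
      \<in> I (leaves s + leaves t - 1)"
    using ideal d(1) s assms(3,4) unfolding operad_ideal_def by blast
  then show ?thesis
    using assms(3,4) d(2) by (simp add: congruent_mod_def free_binary_eq bilinear_extension_diff leaves_graft)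
qed

text \<open>The leaves are filled from right to left, so that positions 2 and 1 are not shifted by
  the earlier graftings.\<close>

lemma congruent_mod_substitute:
  assumes "congruent_mod I p q" "leaves p = 3" "binary_tree Q s" "binary_tree Q t" "binary_tree Q u"
  shows "congruent_mod I (graft (graft (graft p 3 u) 2 t) 1 s) (graft (graft (graft q 3 u) 2 t) 1 s)"
proof -
  have "1 \<le> leaves t" "1 \<le> leaves u"
    using assms schroeder_tree_leaves_pos schroeder_tree_binary by blast+
  then show ?thesis
    using assms by (intro congruent_mod_graft_left) (auto simp: leaves_graft)
qed

end

lemma As_relations_simp:
  "As_relations Q r = (\<lambda>n. if n = 3 then
      {Poly_Mapping.single (Node a [Node b [Leaf, Leaf], Leaf]) 1
        - Poly_Mapping.single (Node (poset_min r a b) [Leaf, Node (poset_min r a b) [Leaf, Leaf]]) 1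
          | a b. a \<in> Q \<and> b \<in> Q \<and> comparable r a b} \<union>
      {Poly_Mapping.single (Node (poset_min r a b) [Node (poset_min r a b) [Leaf, Leaf], Leaf]) 1
        - Poly_Mapping.single (Node a [Leaf, Node b [Leaf, Leaf]]) 1
          | a b. a \<in> Q \<and> b \<in> Q \<and> comparable r a b}
     else {})"
  by (auto simp: As_relations_def free_binary_eq star_def Let_def fun_eq_iff)

lemma assoc_equiv_congruent_mod:
  assumes I: "operad_ideal (free_binary Q) I" "As_relations Q r 3 \<subseteq> I 3"
  shows "assoc_equiv Q r s t \<Longrightarrow> congruent_mod I s t"
proof (induction rule: assoc_equiv.induct)
  case (refl t)
  show ?case using free_binary_ideal_closed(1)[OF I(1)] by (simp add: congruent_mod_def)
next
  case (sym s t)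
  then show ?case using congruent_mod_sym[OF I(1)] by blast
next
  case (trans s t u)
  then show ?case using congruent_mod_trans[OF I(1)] by blast
next
  case (cong a s s' t t')
  have bin: "binary_tree Q t" "binary_tree Q s'" using cong assoc_equiv_binary_tree by auto
  \<comment> \<open>The children are replaced one at a time; once \<open>s'\<close> is in place, the
    right leaf has position \<open>leaves s' + 1\<close>.\<close>
  have "congruent_mod I (graft (Node a [Leaf, t]) 1 s) (graft (Node a [Leaf, t]) 1 s')"
    using cong bin by (intro congruent_mod_graft_right[OF I(1)]) auto
  moreover have "congruent_mod I (graft (Node a [s', Leaf]) (leaves s' + 1) t)
      (graft (Node a [s', Leaf]) (leaves s' + 1) t')"
    using cong bin by (intro congruent_mod_graft_right[OF I(1)]) auto
  ultimately show ?case using congruent_mod_trans[OF I(1)] by fastforce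
next
  case (left a b s t u)
  have "congruent_mod I (Node a [Node b [Leaf, Leaf], Leaf])
      (Node (poset_min r a b) [Leaf, Node (poset_min r a b) [Leaf, Leaf]])"
    using left I(2) unfolding As_relations_simp congruent_mod_def by (auto simp: numeral_3_eq_3)
  from congruent_mod_substitute[OF I(1) this _ left(4-6)] show ?case by simp
next
  case (right a b s t u)
  have "congruent_mod I (Node (poset_min r a b) [Node (poset_min r a b) [Leaf, Leaf], Leaf])
      (Node a [Leaf, Node b [Leaf, Leaf]])"
    using right I(2) unfolding As_relations_simp congruent_mod_def by (auto simp: numeral_3_eq_3)
  from congruent_mod_substitute[OF I(1) this _ right(4-6)] show ?case by simp
qed

section \<open>Normalisation as an operad morphism and its kernel\<close>

context forest
begin

abbreviation nf :: "('q ptree \<Rightarrow>\<^sub>0 'k::field) \<Rightarrow> 'q ptree \<Rightarrow>\<^sub>0 'k" where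
  "nf \<equiv> linear_extension (normal_form r)"

abbreviation kernel :: "nat \<Rightarrow> ('q ptree \<Rightarrow>\<^sub>0 'k::field) set" where
  "kernel n \<equiv> {p \<in> elements (free_binary Q) n. nf p = 0}"

lemma nf_pcomp:
  assumes "p \<in> elements (free_binary Q) k" "q \<in> elements (free_binary Q) n" "1 \<le> i" "i \<le> k"
  shows "nf (pcomp (free_binary Q) k n i p q) = pcomp (ASchr Q r) k n i (nf p) (nf q)"
  unfolding free_binary_eq ASchr_def tree_operad_simps
  \<comment> \<open>Reducing the left argument needs \<open>i\<close> in range, hence basis trees
    with \<open>k\<close> leaves; on the right any tree will do.\<close>
  by (rule linear_extension_bilinear_extension[of p "{t. leaves t = k}" q "UNIV"])
    (use assms in \<open>auto simp: free_binary_eq normal_form_graft_left normal_form_graft_right\<close>)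

lemma normal_form_corolla3:
  assumes "a \<asymp> b"
  shows "normal_form r (Node b [Node a [Leaf, Leaf], Leaf]) = normal_form r (Node (m a b) [Leaf, Leaf, Leaf])"
    and "normal_form r (Node b [Leaf, Node a [Leaf, Leaf]]) = normal_form r (Node (m a b) [Leaf, Leaf, Leaf])"
  using contract.edge[OF assms, of "[]" "[Leaf, Leaf]" "[Leaf]"]
    contract.edge[OF assms, of "[Leaf]" "[Leaf, Leaf]" "[]"]
  by (auto intro: normal_form_eqI)

lemma diff_single_kernel:
  assumes "bin s" "bin t" "leaves s = n" "leaves t = n" "normal_form r s = normal_form r t"
  shows "Poly_Mapping.single s 1 - Poly_Mapping.single t 1 \<in> kernel n"
  using assms keys_diff[of "Poly_Mapping.single s 1" "Poly_Mapping.single t 1"]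
  by (auto simp: free_binary_eq linear_extension_diff)

lemma As_relations_kernel: "As_relations Q r n \<subseteq> kernel n"
proof (cases "n = 3")
  case True
  \<comment> \<open>In each relation one tree carries the minimum at both nodes; its normal form is
    the instance of \<open>normal_form_corolla3\<close> with equal labels.\<close>
  have diag: "m a b \<asymp> m a b" "m (m a b) (m a b) = m a b" if "a \<in> Q" "b \<in> Q" for a b
    using that by (auto simp: cmp_refl poset_min_def)
  have "Poly_Mapping.single (Node a [Node b [Leaf, Leaf], Leaf]) 1
      - Poly_Mapping.single (Node (m a b) [Leaf, Node (m a b) [Leaf, Leaf]]) 1 \<in> kernel 3"
    "Poly_Mapping.single (Node (m a b) [Node (m a b) [Leaf, Leaf], Leaf]) 1
      - Poly_Mapping.single (Node a [Leaf, Node b [Leaf, Leaf]]) 1 \<in> kernel 3"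
    if "a \<in> Q" "b \<in> Q" "a \<asymp> b" for a b
  proof -
    have ba: "b \<asymp> a" "m b a = m a b"
      using that(3) min_commute[of a b] by (simp_all add: comparable_commute)
    note corolla = normal_form_corolla3[OF ba(1)] normal_form_corolla3[OF diag(1)[OF that(1,2)]]
    show "Poly_Mapping.single (Node a [Node b [Leaf, Leaf], Leaf]) 1
        - Poly_Mapping.single (Node (m a b) [Leaf, Node (m a b) [Leaf, Leaf]]) 1 \<in> kernel 3"
      by (rule diff_single_kernel) (simp_all add: that corolla ba(2) diag(2))
    show "Poly_Mapping.single (Node (m a b) [Node (m a b) [Leaf, Leaf], Leaf]) 1
        - Poly_Mapping.single (Node a [Leaf, Node b [Leaf, Leaf]]) 1 \<in> kernel 3"
      by (rule diff_single_kernel) (simp_all add: that corolla ba(2) diag(2))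
  qed
  then show ?thesis unfolding As_relations_simp True by (auto simp del: mem_Collect_eq)
qed (simp add: As_relations_simp)

lemma operad_ideal_kernel:
  "operad_ideal (free_binary Q :: ('k::field, 'q ptree \<Rightarrow>\<^sub>0 'k) ns_operad) kernel"
  unfolding operad_ideal_def
proof (intro conjI allI impI)
  fix n
  interpret M: module scalars "tree_space {t. bin t} n :: ('k, 'q ptree \<Rightarrow>\<^sub>0 'k) module"
    by (rule module_tree_space)
  \<comment> \<open>Negation is derived from the abstract additive group of the module and has to be
    identified with the pointwise one.\<close>
  have neg: "\<ominus>\<^bsub>tree_space {t. bin t} n\<^esub> p = - p"
    if "p \<in> carrier (tree_space {t. bin t} n)" for p :: "'q ptree \<Rightarrow>\<^sub>0 'k"
    using M.minus_equality[of "- p" p] that by simp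
  have kernel: "kernel n = {p. Poly_Mapping.keys p \<subseteq> {t. bin t \<and> leaves t = n} \<and> nf p = (0 :: 'q ptree \<Rightarrow>\<^sub>0 'k)}"
    by (simp add: free_binary_eq)
  have "submodule (kernel n :: ('q ptree \<Rightarrow>\<^sub>0 'k) set) scalars (tree_space {t. bin t} n)"
    unfolding kernel
  proof (rule M.submoduleI, goal_cases)
    case (3 p)
    then show ?case using linear_extension_diff[of "normal_form r" 0 p] by (simp add: neg)
  next
    case (4 p q)
    then show ?case using keys_add[of p q] by auto
  next
    case (5 c p)
    then show ?case using keys_scale[of c p] by (auto simp: scale_simps)
  qed auto
  then show "submodule (kernel n) scalars (component (free_binary Q :: ('k, 'q ptree \<Rightarrow>\<^sub>0 'k) ns_operad) n)"
    by (simp add: free_binary_eq)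
next
  fix k n i and x y :: "'q ptree \<Rightarrow>\<^sub>0 'k"
  assume "1 \<le> i \<and> i \<le> k \<and> (x \<in> kernel k \<and> y \<in> elements (free_binary Q) n \<or>
    x \<in> elements (free_binary Q) k \<and> y \<in> kernel n)"
  then show "pcomp (free_binary Q) k n i x y \<in> kernel (k + n - 1)"
    using ns_operad.pcomp_closed[OF ns_operad_free_binary, of x Q k y n i] nf_pcomp[of x k y n i]
    by (auto simp: ASchr_def)
qed

text \<open>For every \<open>p\<close> supported on binary trees with \<open>n\<close> leaves,
  \<open>p - linear_extension binarize (nf p)\<close> lies in \<open>I n\<close>: on a single tree
  this is \<open>binarize_normal_form\<close>, and the rest is linearity. On the kernel the second
  term vanishes.\<close>

lemma nf_kernel_generated:
  assumes I: "operad_ideal (free_binary Q) I" "As_relations Q r 3 \<subseteq> (I 3 :: ('q ptree \<Rightarrow>\<^sub>0 'k::field) set)"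
  shows "kernel n \<subseteq> I n"
proof
  fix p :: "'q ptree \<Rightarrow>\<^sub>0 'k" assume p: "p \<in> kernel n"
  note closed = free_binary_ideal_closed[OF I(1)]
  have "Poly_Mapping.keys p \<subseteq> {t. bin t \<and> leaves t = n}" using p by (auto simp: free_binary_eq)
  then have "p - linear_extension binarize (nf p) \<in> I n"
  proof (induction p rule: poly_mapping_span_induct)
    case zero
    then show ?case using closed(1) by simp
  next
    case (single t a)
    then have "Poly_Mapping.single t 1 - Poly_Mapping.single (binarize (normal_form r t)) 1 \<in> I n"
      using assoc_equiv_congruent_mod[OF I binarize_normal_form[of t]] by (auto simp: congruent_mod_def)
    from closed(3)[OF this, of a] show ?case by (simp add: scale_diff)
  next
    case (add p q)
    then show ?case using closed(2)[OF add(3,4)] by (simp add: algebra_simps)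
  qed
  then show "p \<in> I n" using p by simp
qed

text \<open>The kernel is one of the ideals that are intersected, and it is contained in all of
  them.\<close>

lemma generated_ideal_eq_kernel:
  "generated_ideal (free_binary Q) (As_relations Q r) n = kernel n"
proof
  show "generated_ideal (free_binary Q) (As_relations Q r) n \<subseteq> kernel n"
    using operad_ideal_kernel As_relations_kernel unfolding generated_ideal_def by blast
  show "kernel n \<subseteq> generated_ideal (free_binary Q) (As_relations Q r) n"
    using nf_kernel_generated unfolding generated_ideal_def by blast
qed

lemma nf_surj:
  "nf ` elements (free_binary Q) n = (elements (ASchr Q r) n :: ('q ptree \<Rightarrow>\<^sub>0 'k::field) set)"
proof (intro equalityI subsetI)
  fix q :: "'q ptree \<Rightarrow>\<^sub>0 'k" assume "q \<in> nf ` elements (free_binary Q) n"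
  then obtain p where p: "q = nf p" "Poly_Mapping.keys p \<subseteq> {t. bin t \<and> leaves t = n}"
    by (auto simp: free_binary_eq)
  have "normal_form r ` Poly_Mapping.keys p \<subseteq> {t. schroeder_tree Q t \<and> alternating r t \<and> leaves t = n}"
    using p(2) by (auto simp: schroeder_tree_normal_form alternating_normal_form schroeder_tree_binary)
  then show "q \<in> elements (ASchr Q r) n"
    using keys_linear_extension[of "normal_form r" p] p(1) by (auto simp: ASchr_def)
next
  fix q :: "'q ptree \<Rightarrow>\<^sub>0 'k" assume "q \<in> elements (ASchr Q r) n"
  then have q: "Poly_Mapping.keys q \<subseteq> {t. schroeder_tree Q t \<and> alternating r t \<and> leaves t = n}"
    by (auto simp: ASchr_def)
  then have eq: "nf (linear_extension binarize q) = q"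
    unfolding linear_extension_comp by (intro linear_extension_ident) (auto simp: normal_form_binarize)
  have "Poly_Mapping.keys (linear_extension binarize q) \<subseteq> {t. bin t \<and> leaves t = n}"
    using keys_linear_extension[of binarize q] q binary_tree_binarize leaves_binarize by blast
  then have "linear_extension binarize q \<in> elements (free_binary Q) n"
    by (simp add: free_binary_eq)
  from imageI[OF this, of nf] show "q \<in> nf ` elements (free_binary Q) n"
    unfolding eq .
qed

theorem As_ASchr_isomorphic:
  "operads_isomorphic (As Q r :: ('k::field, ('q ptree \<Rightarrow>\<^sub>0 'k) set) ns_operad) (ASchr Q r)"
proof -
  let ?F = "free_binary Q :: ('k, 'q ptree \<Rightarrow>\<^sub>0 'k) ns_operad"
  let ?A = "ASchr Q r :: ('k, 'q ptree \<Rightarrow>\<^sub>0 'k) ns_operad"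
  have "operads_isomorphic (quotient_operad ?F (generated_ideal ?F (As_relations Q r))) ?A"
  proof (rule quotient_operad_isomorphic[where P = ?F and R = ?A and \<phi> = "\<lambda>n. nf :: ('q ptree \<Rightarrow>\<^sub>0 'k) \<Rightarrow> 'q ptree \<Rightarrow>\<^sub>0 'k"
        and I = "generated_ideal ?F (As_relations Q r)"])
    show "ns_operad ?F" by (rule ns_operad_free_binary)
    show "ns_operad ?A"
      unfolding ASchr_def by (intro tree_composition.ns_operad tree_composition_normal_form)
    show "nf ` elements ?F n = elements ?A n" for n by (rule nf_surj)
    show "nf (ounit ?F) = ounit ?A"
      by (simp add: free_binary_eq ASchr_def normal_form_alternating)
    show "nf (pcomp ?F k n i x y) = pcomp ?A k n i (nf x) (nf y)"
      if "x \<in> elements ?F k" "y \<in> elements ?F n" "1 \<le> i" "i \<le> k" for k n i x y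
      using that by (rule nf_pcomp)
    show "generated_ideal ?F (As_relations Q r) n
        = {x \<in> elements ?F n. nf x = \<zero>\<^bsub>component ?A n\<^esub>}" for n
      by (simp add: generated_ideal_eq_kernel ASchr_def)
  qed (simp_all add: free_binary_eq ASchr_def)
  then show ?thesis by (simp add: As_def)
qed

end

theorem theorem3p10:
  fixes Q :: "'q set" and r :: "'q rel"
  assumes "finite Q" and "forest_poset Q r"
  shows "operads_isomorphic
    (As Q r :: ('k::field_char_0, ('q ptree \<Rightarrow>\<^sub>0 'k) set) ns_operad)
    (ASchr Q r :: ('k, 'q ptree \<Rightarrow>\<^sub>0 'k) ns_operad)"
  using forest.As_ASchr_isomorphic[OF forest.intro[OF assms(2)]] .

end
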